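(* Let $\Gamma$ be a finite graph with vertex set $V$, and let $(G_v,A_v)_{v\in V}$ and $(G^*_v,A^*_v)_{v\in V}$ be two families of group pairs (a group and a subgroup of it) indexed by $V$. Suppose that for all $v\in V$ there exist subgroups $H_v<G_v$ and $H^*_v<G^*_v$ of finite index such that the left action of $H_v$ on $G_v/A_v$ and the left action of $H^*_v$ on $G^*_v/A^*_v$ are equivariantly isomorphic. Then the graph products $\mathbf G=\Pi_\Gamma(G_v,A_v)$ and $\mathbf G^*=\Pi_\Gamma(G_v^*,A_v^* )$ are commensurable.
   Context: A graph $\Gamma$ on the vertex set $V$ is an antireflexive symmetric relation on $V$. A complete subgraph is a subset $S\subset V$ whose elements are pairwise adjacent (the empty set and singletons are included). Given for each $v\in V$ a group $G_v$ with a subgroup $A_v<G_v$, put $G_S=\prod_{v\in S}G_v\times\prod_{v\in V\setminus S}A_v$ for each complete subgraph $S$. The graph product of pairs $\Pi_\Gamma(G_v,A_v)$ is the direct limit (colimit in groups) of the groups $G_S$, with the obvious inclusions, over the poset of complete subgraphs of $\Gamma$ ordered by inclusion. An action of a group $H$ on $X$ and an action of a group $H^*$ on $X^*$ are equivariantly isomorphic if there are a group isomorphism $\varphi:H\to H^*$ and a bijection $f:X\to X^*$ with $f(hx)=\varphi(h)f(x)$ for all $h\in H$, $x\in X$. Two groups are commensurable if there is a group isomorphic to a subgroup of finite index in each of them. *)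

theory Defs
  imports "HOL-Algebra.Product_Groups" "HOL-Algebra.Group_Action" "HOL-Algebra.Left_Coset"
begin

section \<open>Colimits of groups over a preordered index set\<close>

text \<open>
  A diagram consists of an index set \<open>I\<close> with a relation \<open>leq\<close>, groups \<open>D i\<close> and homomorphisms
  \<open>f i j\<close> from \<open>D i\<close> to \<open>D j\<close> for \<open>leq i j\<close>.  Its colimit in the category of groups is constructed
  as the monoid of words with letters in the disjoint union of the groups \<open>D i\<close>, modulo the
  congruence generated by the multiplication tables of the \<open>D i\<close> and by the identification of each
  letter with its images under the transition maps.  Theorem \<open>group_colimit_universal\<close> below is
  the universal property.
\<close>

definition diagram_words :: "'i set \<Rightarrow> ('i \<Rightarrow> ('g, 'm) monoid_scheme) \<Rightarrow> ('i \<times> 'g) list set"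
  where "diagram_words I D = lists (SIGMA i:I. carrier (D i))"

inductive colimit_eq ::
  "'i set \<Rightarrow> ('i \<Rightarrow> 'i \<Rightarrow> bool) \<Rightarrow> ('i \<Rightarrow> ('g, 'm) monoid_scheme) \<Rightarrow> ('i \<Rightarrow> 'i \<Rightarrow> 'g \<Rightarrow> 'g) \<Rightarrow>
    ('i \<times> 'g) list \<Rightarrow> ('i \<times> 'g) list \<Rightarrow> bool"
  for I leq D f
where
  ceq_refl: "w \<in> diagram_words I D \<Longrightarrow> colimit_eq I leq D f w w"
| ceq_sym: "colimit_eq I leq D f u w \<Longrightarrow> colimit_eq I leq D f w u"
| ceq_trans: "colimit_eq I leq D f u v \<Longrightarrow> colimit_eq I leq D f v w \<Longrightarrow> colimit_eq I leq D f u w"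
| ceq_append: "colimit_eq I leq D f u u' \<Longrightarrow> colimit_eq I leq D f w w' \<Longrightarrow>
    colimit_eq I leq D f (u @ w) (u' @ w')"
| ceq_one: "i \<in> I \<Longrightarrow> colimit_eq I leq D f [(i, \<one>\<^bsub>D i\<^esub>)] []"
| ceq_mult: "i \<in> I \<Longrightarrow> x \<in> carrier (D i) \<Longrightarrow> y \<in> carrier (D i) \<Longrightarrow>
    colimit_eq I leq D f [(i, x), (i, y)] [(i, x \<otimes>\<^bsub>D i\<^esub> y)]"
| ceq_map: "i \<in> I \<Longrightarrow> j \<in> I \<Longrightarrow> leq i j \<Longrightarrow> x \<in> carrier (D i) \<Longrightarrow>
    colimit_eq I leq D f [(i, x)] [(j, f i j x)]"

definition colimit_class ::
  "'i set \<Rightarrow> ('i \<Rightarrow> 'i \<Rightarrow> bool) \<Rightarrow> ('i \<Rightarrow> ('g, 'm) monoid_scheme) \<Rightarrow> ('i \<Rightarrow> 'i \<Rightarrow> 'g \<Rightarrow> 'g) \<Rightarrow>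
    ('i \<times> 'g) list \<Rightarrow> ('i \<times> 'g) list set"
  where "colimit_class I leq D f w = {u. colimit_eq I leq D f w u}"

definition group_colimit ::
  "'i set \<Rightarrow> ('i \<Rightarrow> 'i \<Rightarrow> bool) \<Rightarrow> ('i \<Rightarrow> ('g, 'm) monoid_scheme) \<Rightarrow> ('i \<Rightarrow> 'i \<Rightarrow> 'g \<Rightarrow> 'g) \<Rightarrow>
    ('i \<times> 'g) list set monoid"
  where "group_colimit I leq D f =
    \<lparr> carrier = colimit_class I leq D f ` diagram_words I D,
      monoid.mult = (\<lambda>P Q. \<Union>u\<in>P. \<Union>w\<in>Q. colimit_class I leq D f (u @ w)),
      one = colimit_class I leq D f [] \<rparr>"

definition colimit_inj ::
  "'i set \<Rightarrow> ('i \<Rightarrow> 'i \<Rightarrow> bool) \<Rightarrow> ('i \<Rightarrow> ('g, 'm) monoid_scheme) \<Rightarrow> ('i \<Rightarrow> 'i \<Rightarrow> 'g \<Rightarrow> 'g) \<Rightarrow>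
    'i \<Rightarrow> 'g \<Rightarrow> ('i \<times> 'g) list set"
  where "colimit_inj I leq D f i x = colimit_class I leq D f [(i, x)]"

locale group_diagram =
  fixes I :: "'i set" and leq :: "'i \<Rightarrow> 'i \<Rightarrow> bool"
    and D :: "'i \<Rightarrow> ('g, 'm) monoid_scheme" and f :: "'i \<Rightarrow> 'i \<Rightarrow> 'g \<Rightarrow> 'g"
  assumes group_D: "i \<in> I \<Longrightarrow> group (D i)"
    and hom_f: "i \<in> I \<Longrightarrow> j \<in> I \<Longrightarrow> leq i j \<Longrightarrow> f i j \<in> hom (D i) (D j)"
begin

abbreviation "W \<equiv> diagram_words I D"
abbreviation "ceq \<equiv> colimit_eq I leq D f"
abbreviation "cls \<equiv> colimit_class I leq D f"
abbreviation "C \<equiv> group_colimit I leq D f"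
abbreviation "cinj \<equiv> colimit_inj I leq D f"

lemma ceq_words: "ceq u w \<Longrightarrow> u \<in> W \<and> w \<in> W"
proof (induction rule: colimit_eq.induct)
  case (ceq_one i)
  then show ?case using group_D by (auto simp: diagram_words_def intro: group.is_monoid monoid.one_closed)
next
  case (ceq_mult i x y)
  then show ?case using group_D by (auto simp: diagram_words_def intro: group.is_monoid monoid.m_closed)
next
  case (ceq_map i j x)
  then show ?case using hom_in_carrier[OF hom_f[of i j]] by (auto simp: diagram_words_def)
qed (auto simp: diagram_words_def)

lemma cls_eq_iff: "u \<in> W \<Longrightarrow> cls u = cls w \<longleftrightarrow> ceq u w"
  unfolding colimit_class_def by (metis (no_types, lifting) Collect_cong ceq_refl ceq_sym ceq_trans mem_Collect_eq)

lemma carrier_C: "carrier C = cls ` W"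
  by (simp add: group_colimit_def)

lemma one_C: "\<one>\<^bsub>C\<^esub> = cls []"
  by (simp add: group_colimit_def)

lemma word_append: "u \<in> W \<Longrightarrow> w \<in> W \<Longrightarrow> u @ w \<in> W"
  by (simp add: diagram_words_def)

lemma mult_C:
  assumes "u \<in> W" "w \<in> W"
  shows "cls u \<otimes>\<^bsub>C\<^esub> cls w = cls (u @ w)"
proof -
  have "cls (u' @ w') = cls (u @ w)" if "u' \<in> cls u" "w' \<in> cls w" for u' w'
  proof -
    have "ceq (u @ w) (u' @ w')"
      using that by (auto simp: colimit_class_def intro: ceq_append)
    then show ?thesis
      using cls_eq_iff[OF word_append[OF assms], of "u' @ w'"] by simp
  qed
  moreover have "u \<in> cls u" "w \<in> cls w"
    using assms by (auto simp: colimit_class_def intro: ceq_refl)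
  ultimately have "(\<Union>u'\<in>cls u. \<Union>w'\<in>cls w. cls (u' @ w')) = cls (u @ w)"
    by blast
  then show ?thesis
    by (simp add: group_colimit_def)
qed

lemma word_single: "i \<in> I \<Longrightarrow> x \<in> carrier (D i) \<Longrightarrow> [(i, x)] \<in> W"
  by (simp add: diagram_words_def)

lemma word_Nil: "[] \<in> W"
  by (simp add: diagram_words_def)

lemma ex_left_inverse: "w \<in> W \<Longrightarrow> \<exists>w'\<in>W. ceq (w' @ w) []"
proof (induction w)
  case Nil
  then show ?case by (auto intro!: bexI[of _ "[]"] ceq_refl)
next
  case (Cons p w)
  obtain i x where p: "p = (i, x)" by (cases p)
  have i: "i \<in> I" and x: "x \<in> carrier (D i)" and w: "w \<in> W"
    using Cons.prems by (auto simp: diagram_words_def p)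
  interpret group "D i" by (rule group_D[OF i])
  obtain w' where w': "w' \<in> W" "ceq (w' @ w) []" using Cons.IH[OF w] by blast
  have "ceq [(i, inv\<^bsub>D i\<^esub> x), (i, x)] []"
  proof (rule ceq_trans)
    show "ceq [(i, inv\<^bsub>D i\<^esub> x), (i, x)] [(i, inv\<^bsub>D i\<^esub> x \<otimes>\<^bsub>D i\<^esub> x)]"
      using i x by (intro ceq_mult) simp_all
    show "ceq [(i, inv\<^bsub>D i\<^esub> x \<otimes>\<^bsub>D i\<^esub> x)] []"
      using ceq_one[OF i, of leq D f] x by simp
  qed
  then have "ceq (w' @ [(i, inv\<^bsub>D i\<^esub> x), (i, x)] @ w) (w' @ [] @ w)"
    by (intro ceq_append ceq_refl w' w)
  then have "ceq ((w' @ [(i, inv\<^bsub>D i\<^esub> x)]) @ p # w) []"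
    using ceq_trans[OF _ w'(2)] by (simp add: p)
  moreover have "w' @ [(i, inv\<^bsub>D i\<^esub> x)] \<in> W"
    using w'(1) i x by (simp add: diagram_words_def)
  ultimately show ?case by blast
qed

theorem group_colimit_group: "group C"
proof (rule groupI)
  show "a \<otimes>\<^bsub>C\<^esub> b \<in> carrier C" if "a \<in> carrier C" "b \<in> carrier C" for a b
    using that by (auto simp: carrier_C mult_C word_append)
  show "\<one>\<^bsub>C\<^esub> \<in> carrier C" by (simp add: carrier_C one_C word_Nil)
  show "a \<otimes>\<^bsub>C\<^esub> b \<otimes>\<^bsub>C\<^esub> c = a \<otimes>\<^bsub>C\<^esub> (b \<otimes>\<^bsub>C\<^esub> c)"
    if "a \<in> carrier C" "b \<in> carrier C" "c \<in> carrier C" for a b c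
    using that by (auto simp: carrier_C mult_C word_append)
  show "\<one>\<^bsub>C\<^esub> \<otimes>\<^bsub>C\<^esub> a = a" if "a \<in> carrier C" for a
    using that by (auto simp: carrier_C one_C mult_C word_Nil)
  show "\<exists>b\<in>carrier C. b \<otimes>\<^bsub>C\<^esub> a = \<one>\<^bsub>C\<^esub>" if a: "a \<in> carrier C" for a
  proof -
    obtain w where w: "w \<in> W" "a = cls w" using a by (auto simp: carrier_C)
    obtain w' where w': "w' \<in> W" "ceq (w' @ w) []" using ex_left_inverse[OF w(1)] by blast
    then have "cls w' \<otimes>\<^bsub>C\<^esub> a = \<one>\<^bsub>C\<^esub>"
      using w by (simp add: mult_C one_C cls_eq_iff word_append)
    then show ?thesis using w'(1) by (auto simp: carrier_C)
  qed
qed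

theorem colimit_inj_hom: "i \<in> I \<Longrightarrow> cinj i \<in> hom (D i) C"
proof (rule homI)
  fix x assume "i \<in> I" "x \<in> carrier (D i)"
  then show "cinj i x \<in> carrier C" by (auto simp: carrier_C colimit_inj_def word_single)
next
  fix x y assume *: "i \<in> I" "x \<in> carrier (D i)" "y \<in> carrier (D i)"
  interpret group "D i" by (rule group_D[OF *(1)])
  have "ceq [(i, x \<otimes>\<^bsub>D i\<^esub> y)] ([(i, x)] @ [(i, y)])"
    using ceq_mult[of i I x D y leq f] * by (simp add: ceq_sym)
  then show "cinj i (x \<otimes>\<^bsub>D i\<^esub> y) = cinj i x \<otimes>\<^bsub>C\<^esub> cinj i y"
    using * by (simp add: colimit_inj_def mult_C word_single cls_eq_iff)
qed

theorem colimit_inj_compat: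
  "i \<in> I \<Longrightarrow> j \<in> I \<Longrightarrow> leq i j \<Longrightarrow> x \<in> carrier (D i) \<Longrightarrow> cinj j (f i j x) = cinj i x"
  by (metis cls_eq_iff colimit_inj_def ceq_map word_single)

theorem group_colimit_universal:
  fixes K :: "('k, 'n) monoid_scheme"
  assumes K: "group K"
    and h: "\<And>i. i \<in> I \<Longrightarrow> h i \<in> hom (D i) K"
    and compat: "\<And>i j x. i \<in> I \<Longrightarrow> j \<in> I \<Longrightarrow> leq i j \<Longrightarrow> x \<in> carrier (D i) \<Longrightarrow> h j (f i j x) = h i x"
  shows "\<exists>\<psi>\<in>hom C K. (\<forall>i\<in>I. \<forall>x\<in>carrier (D i). \<psi> (cinj i x) = h i x) \<and>
    (\<forall>\<psi>'\<in>hom C K. (\<forall>i\<in>I. \<forall>x\<in>carrier (D i). \<psi>' (cinj i x) = h i x) \<longrightarrow>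
      (\<forall>c\<in>carrier C. \<psi>' c = \<psi> c))"
proof -
  interpret K: group K by (rule K)
  define ev where "ev w = foldr (\<lambda>(i, x) k. h i x \<otimes>\<^bsub>K\<^esub> k) w \<one>\<^bsub>K\<^esub>" for w
  have hc: "h i x \<in> carrier K" if "i \<in> I" "x \<in> carrier (D i)" for i x
    using hom_in_carrier[OF h] that by blast
  have ev_closed: "ev w \<in> carrier K" if "w \<in> W" for w
    using that by (induction w) (auto simp: ev_def diagram_words_def hc)
  have ev_append: "ev (u @ w) = ev u \<otimes>\<^bsub>K\<^esub> ev w" if "u \<in> W" "w \<in> W" for u w
    using that
  proof (induction u)
    case Nil
    then show ?case using ev_closed by (simp add: ev_def)
  next
    case (Cons p u)
    obtain i x where p: "p = (i, x)" by (cases p)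
    have "i \<in> I" "x \<in> carrier (D i)" "u \<in> W" using Cons.prems by (auto simp: diagram_words_def p)
    moreover have "ev (p # v) = h i x \<otimes>\<^bsub>K\<^esub> ev v" for v by (simp add: ev_def p)
    ultimately show ?case using Cons ev_closed hc by (simp add: K.m_assoc)
  qed
  have ev_ceq: "ev u = ev w" if "ceq u w" for u w
    using that
  proof (induction rule: colimit_eq.induct)
    case (ceq_append u u' w w')
    then show ?case using ceq_words[of u u'] ceq_words[of w w'] by (simp add: ev_append)
  next
    case (ceq_one i)
    interpret group_hom "D i" K "h i"
      using ceq_one by (simp add: group_hom_def group_hom_axioms_def group_D h K)
    show ?case by (simp add: ev_def)
  next
    case (ceq_mult i x y)
    then show ?case using hom_mult[OF h] by (simp add: ev_def hc)
  qed (auto simp: ev_def compat)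
  define \<psi> where "\<psi> P = ev (SOME w. w \<in> P)" for P
  have \<psi>_cls: "\<psi> (cls w) = ev w" if "w \<in> W" for w
  proof -
    have "w \<in> cls w" using that by (simp add: colimit_class_def ceq_refl)
    then have "(SOME w'. w' \<in> cls w) \<in> cls w" by (rule someI)
    then show ?thesis unfolding \<psi>_def using ev_ceq by (auto simp: colimit_class_def)
  qed
  have "\<psi> \<in> hom C K"
    by (rule homI) (auto simp: carrier_C mult_C \<psi>_cls ev_closed ev_append word_append)
  moreover have \<psi>_inj: "\<psi> (cinj i x) = h i x" if "i \<in> I" "x \<in> carrier (D i)" for i x
    using that by (simp add: colimit_inj_def \<psi>_cls word_single ev_def hc)
  moreover have "\<psi>' c = \<psi> c"
    if \<psi>': "\<psi>' \<in> hom C K" "\<forall>i\<in>I. \<forall>x\<in>carrier (D i). \<psi>' (cinj i x) = h i x" and c: "c \<in> carrier C"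
    for \<psi>' c
  proof -
    interpret \<psi>': group_hom C K \<psi>'
      using \<psi>'(1) by (simp add: group_hom_def group_hom_axioms_def group_colimit_group K)
    have "\<psi>' (cls w) = ev w" if "w \<in> W" for w
      using that
    proof (induction w)
      case Nil
      then show ?case using \<psi>'.hom_one by (simp add: one_C ev_def)
    next
      case (Cons p w)
      obtain i x where p: "p = (i, x)" by (cases p)
      have *: "i \<in> I" "x \<in> carrier (D i)" "w \<in> W" using Cons.prems by (auto simp: diagram_words_def p)
      have "\<psi>' (cls (p # w)) = \<psi>' (cinj i x \<otimes>\<^bsub>C\<^esub> cls w)"
        using mult_C[OF word_single[OF *(1,2)] *(3)] by (simp add: p colimit_inj_def)
      also have "\<dots> = h i x \<otimes>\<^bsub>K\<^esub> ev w"
        using * Cons.IH \<psi>'(2) by (simp add: carrier_C colimit_inj_def word_single)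
      finally show ?case by (simp add: ev_def p)
    qed
    then show ?thesis using c by (auto simp: carrier_C \<psi>_cls)
  qed
  ultimately show ?thesis by blast
qed

end

section \<open>Graph products of group pairs\<close>

definition graph_on :: "'v set \<Rightarrow> ('v \<times> 'v) set \<Rightarrow> bool"
  where "graph_on V E \<longleftrightarrow> E \<subseteq> V \<times> V \<and> irrefl E \<and> sym E"

definition complete_subgraphs :: "'v set \<Rightarrow> ('v \<times> 'v) set \<Rightarrow> 'v set set"
  where "complete_subgraphs V E = {S. S \<subseteq> V \<and> (\<forall>u\<in>S. \<forall>v\<in>S. u \<noteq> v \<longrightarrow> (u, v) \<in> E)}"

definition pair_product ::
  "'v set \<Rightarrow> ('v \<Rightarrow> ('a, 'm) monoid_scheme) \<Rightarrow> ('v \<Rightarrow> 'a set) \<Rightarrow> 'v set \<Rightarrow> ('v \<Rightarrow> 'a) monoid"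
  where "pair_product V G A S =
    product_group V (\<lambda>v. if v \<in> S then G v else (G v)\<lparr>carrier := A v\<rparr>)"

text \<open>
  All the groups \<open>pair_product V G A S\<close> are subgroups of the full product of the \<open>G v\<close>, so the
  transition maps of the diagram are given by the identity function.
\<close>

definition graph_product ::
  "'v set \<Rightarrow> ('v \<times> 'v) set \<Rightarrow> ('v \<Rightarrow> ('a, 'm) monoid_scheme) \<Rightarrow> ('v \<Rightarrow> 'a set) \<Rightarrow>
    ('v set \<times> ('v \<Rightarrow> 'a)) list set monoid"
  where "graph_product V E G A =
    group_colimit (complete_subgraphs V E) (\<subseteq>) (pair_product V G A) (\<lambda>S T x. x)"

lemma group_diagram_pair_product:
  assumes "\<And>v. v \<in> V \<Longrightarrow> group (G v)" and "\<And>v. v \<in> V \<Longrightarrow> subgroup (A v) (G v)"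
  shows "group_diagram (complete_subgraphs V E) (\<subseteq>) (pair_product V G A) (\<lambda>S T x. x)"
proof (rule group_diagram.intro)
  fix S
  show "group (pair_product V G A S)"
    unfolding pair_product_def using assms by (auto intro!: product_group subgroup.subgroup_is_group)
next
  fix S T assume "S \<in> complete_subgraphs V E" "T \<in> complete_subgraphs V E" "S \<subseteq> T"
  have A: "x \<in> carrier (G v)" if "v \<in> V" "x \<in> A v" for v x
    using subgroup.subset[OF assms(2)[OF that(1)]] that(2) by blast
  show "(\<lambda>x. x) \<in> hom (pair_product V G A S) (pair_product V G A T)"
  proof (rule homI)
    fix x assume "x \<in> carrier (pair_product V G A S)"
    then show "x \<in> carrier (pair_product V G A T)"
      using \<open>S \<subseteq> T\<close> A unfolding pair_product_def
      by (fastforce simp: PiE_iff split: if_splits)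
  next
    fix x y
    show "x \<otimes>\<^bsub>pair_product V G A S\<^esub> y = x \<otimes>\<^bsub>pair_product V G A T\<^esub> y"
      by (auto simp: pair_product_def fun_eq_iff restrict_def)
  qed
qed

section \<open>Equivariant isomorphism and commensurability\<close>

text \<open>Translation is restricted to the cosets so that it is a member of \<open>BijGroup\<close>.\<close>

definition coset_action :: "('a, 'm) monoid_scheme \<Rightarrow> 'a set \<Rightarrow> 'a \<Rightarrow> 'a set \<Rightarrow> 'a set"
  where "coset_action G A h = (\<lambda>P\<in>lcosets\<^bsub>G\<^esub> A. h <#\<^bsub>G\<^esub> P)"

lemma coset_action_group_action:
  assumes "group G" and "subgroup A G" and "subgroup H G"
  shows "group_action (G\<lparr>carrier := H\<rparr>) (lcosets\<^bsub>G\<^esub> A) (coset_action G A)"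
proof -
  interpret group G by fact
  interpret H: group "G\<lparr>carrier := H\<rparr>" using assms by (simp add: subgroup.subgroup_is_group)
  note HG = subgroup.mem_carrier[OF assms(3)] and AG = subgroup.subset[OF assms(2)]
  have closed: "h <#\<^bsub>G\<^esub> P \<in> lcosets\<^bsub>G\<^esub> A" if "h \<in> H" "P \<in> lcosets\<^bsub>G\<^esub> A" for h P
    using that HG AG by (auto simp: LCOSETS_def lcos_m_assoc)
  have P_sub: "P \<subseteq> carrier G" if "P \<in> lcosets\<^bsub>G\<^esub> A" for P
    using that lcosets_subset_PowG[OF assms(2)] by blast
  have assoc: "h <#\<^bsub>G\<^esub> (k <#\<^bsub>G\<^esub> P) = (h \<otimes>\<^bsub>G\<^esub> k) <#\<^bsub>G\<^esub> P"
    if "h \<in> H" "k \<in> H" "P \<in> lcosets\<^bsub>G\<^esub> A" for h k P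
    using that HG P_sub by (simp add: lcos_m_assoc)
  have one: "\<one>\<^bsub>G\<^esub> <#\<^bsub>G\<^esub> P = P" if "P \<in> lcosets\<^bsub>G\<^esub> A" for P
    using P_sub[OF that] by (simp add: lcos_mult_one)
  have bij: "coset_action G A h \<in> Bij (lcosets\<^bsub>G\<^esub> A)" if h: "h \<in> H" for h
  proof -
    have h': "inv\<^bsub>G\<^esub> h \<in> H" using h assms(3) by (simp add: subgroup.m_inv_closed)
    have "bij_betw (coset_action G A h) (lcosets\<^bsub>G\<^esub> A) (lcosets\<^bsub>G\<^esub> A)"
      by (rule bij_betw_byWitness[where f' = "coset_action G A (inv\<^bsub>G\<^esub> h)"])
        (use h h' HG in \<open>auto simp: coset_action_def closed assoc one\<close>)
    then show ?thesis by (simp add: Bij_def coset_action_def)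
  qed
  have "coset_action G A \<in> hom (G\<lparr>carrier := H\<rparr>) (BijGroup (lcosets\<^bsub>G\<^esub> A))"
  proof (rule homI)
    fix h k assume hk: "h \<in> carrier (G\<lparr>carrier := H\<rparr>)" "k \<in> carrier (G\<lparr>carrier := H\<rparr>)"
    have "coset_action G A (h \<otimes>\<^bsub>G\<^esub> k) =
        compose (lcosets\<^bsub>G\<^esub> A) (coset_action G A h) (coset_action G A k)"
      using hk by (auto simp: coset_action_def compose_def closed assoc fun_eq_iff)
    then show "coset_action G A (h \<otimes>\<^bsub>G\<lparr>carrier := H\<rparr>\<^esub> k) =
        coset_action G A h \<otimes>\<^bsub>BijGroup (lcosets\<^bsub>G\<^esub> A)\<^esub> coset_action G A k"
      using hk bij by (simp add: BijGroup_def)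
  qed (simp add: BijGroup_def bij)
  then show ?thesis
    by (simp add: group_action_def group_hom_def group_hom_axioms_def group_BijGroup H.is_group)
qed

definition equivariantly_isomorphic ::
  "('h, 'm) monoid_scheme \<Rightarrow> 'x set \<Rightarrow> ('h \<Rightarrow> 'x \<Rightarrow> 'x) \<Rightarrow>
    ('k, 'n) monoid_scheme \<Rightarrow> 'y set \<Rightarrow> ('k \<Rightarrow> 'y \<Rightarrow> 'y) \<Rightarrow> bool"
  where "equivariantly_isomorphic H M act K N act' \<longleftrightarrow>
    (\<exists>\<theta>\<in>iso H K. \<exists>f. bij_betw f M N \<and>
      (\<forall>h\<in>carrier H. \<forall>x\<in>M. f (act h x) = act' (\<theta> h) (f x)))"

definition finite_index_subgroup :: "'a set \<Rightarrow> ('a, 'm) monoid_scheme \<Rightarrow> bool"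
  where "finite_index_subgroup H G \<longleftrightarrow> subgroup H G \<and> finite (rcosets\<^bsub>G\<^esub> H)"

text \<open>
  The common group \<open>K\<close> is taken on the element type of \<open>G\<close>.  This is no restriction; see
  \<open>commensurableI\<close>.
\<close>

definition commensurable :: "('a, 'm) monoid_scheme \<Rightarrow> ('b, 'n) monoid_scheme \<Rightarrow> bool"
  where "commensurable G G' \<longleftrightarrow>
    (\<exists>K :: 'a monoid. group K \<and>
      (\<exists>H. finite_index_subgroup H G \<and> K \<cong> G\<lparr>carrier := H\<rparr>) \<and>
      (\<exists>H'. finite_index_subgroup H' G' \<and> K \<cong> G'\<lparr>carrier := H'\<rparr>))"

lemma commensurableI:
  fixes K :: "('k, 'l) monoid_scheme"
  assumes K: "group K" and G: "group G"
    and H: "finite_index_subgroup H G" and KH: "K \<cong> G\<lparr>carrier := H\<rparr>"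
    and H': "finite_index_subgroup H' G'" and KH': "K \<cong> G'\<lparr>carrier := H'\<rparr>"
  shows "commensurable G G'"
proof -
  define L :: "'a monoid"
    where "L = \<lparr>carrier = H, monoid.mult = (\<otimes>\<^bsub>G\<^esub>), one = \<one>\<^bsub>G\<^esub>\<rparr>"
  have GH: "group (G\<lparr>carrier := H\<rparr>)"
    using H G by (simp add: finite_index_subgroup_def subgroup.subgroup_is_group)
  have id: "(\<lambda>x. x) \<in> iso (G\<lparr>carrier := H\<rparr>) L" "(\<lambda>x. x) \<in> iso L (G\<lparr>carrier := H\<rparr>)"
    by (auto simp: iso_def hom_def L_def bij_betw_def inj_on_def
        subgroup.m_closed[OF H[unfolded finite_index_subgroup_def, THEN conjunct1]])
  have L: "group L"
    using GH unfolding group_def group_axioms_def monoid_def Units_def L_def by simp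
  have "L \<cong> G\<lparr>carrier := H\<rparr>" using id(2) by (rule is_isoI)
  moreover have "L \<cong> G'\<lparr>carrier := H'\<rparr>"
    using iso_trans[OF is_isoI[OF id(2)] iso_trans[OF group.iso_sym[OF K KH] KH']] .
  ultimately show ?thesis
    using L H H' unfolding commensurable_def by blast
qed

end

theory Submission
  imports Defs
begin

text \<open>
  Write \<open>P\<close> for the product of all \<open>G v\<close>, and \<open>\<pi>\<close> for the homomorphism from the graph product
  onto \<open>P\<close> that restricts to the inclusion on every \<open>pair_product V G A S\<close>.  With \<open>H v\<close> of finite
  index in \<open>G v\<close> and \<open>V\<close> finite, the product \<open>H\<close> of the \<open>H v\<close> has finite index in \<open>P\<close>, so
  \<open>K = \<pi>\<^sup>-\<^sup>1(H)\<close> has finite index in the graph product.  The claim is that \<open>K\<close>, up to isomorphism,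
  only depends on the actions of the \<open>H v\<close> on the sets \<open>G v / A v\<close>.

  The geometric reason is that a word with letters \<open>g\<^sub>1, g\<^sub>2, \<dots>\<close> is a path
  \<open>A, g\<^sub>1 A, g\<^sub>1 g\<^sub>2 A, \<dots>\<close> in the product of the coset spaces \<open>G v / A v\<close>, where a letter from
  \<open>pair_product V G A S\<close> moves the current point in the coordinates in \<open>S\<close> only; the defining
  relations of the graph product become homotopies of such paths.  Thus \<open>K\<close> is the group of lifts
  of the action of \<open>H\<close> to a universal cover, and an equivariant bijection of the coset spaces
  carries paths to paths.

  The proof turns this into algebra.  The bijections of cosets, normalised to send \<open>A v\<close> to
  \<open>A' v\<close>, lift to maps \<open>\<sigma> v\<close> from \<open>G v\<close> to \<open>G' v\<close> with \<open>\<sigma> (h k) = \<sigma> h \<sigma> k\<close> for \<open>h\<close> in \<open>H v\<close>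
  (\<open>ex_mutually_inverse_lifts\<close>).  These are not homomorphisms, but together they give a map \<open>\<sigma>\<close> on
  \<open>P\<close>, and the path that starts at \<open>k\<close> with the letter \<open>g\<close> is carried to the path that starts at
  \<open>\<sigma> k\<close> with the letter \<open>(\<sigma> k)\<^sup>-\<^sup>1 \<sigma> (k g)\<close>.  Extending this to words yields a cocycle on the
  graph product, depending on the starting point \<open>k\<close>.  By equivariance it is unchanged when the
  starting point is multiplied on the left by an element of \<open>H\<close>; hence the cocycle that starts at
  \<open>1\<close> is a homomorphism on \<open>K\<close>.  The cocycle of a lift \<open>\<tau>\<close> of the inverse bijections
  undoes it up to conjugation by the elements \<open>k\<^sup>-\<^sup>1 \<tau> (\<sigma> k)\<close> of the product of the \<open>A v\<close>
  (\<open>cocycle_cocycle\<close>), which are trivial for \<open>k\<close> in \<open>H\<close>.  So it is an isomorphism between the two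
  subgroups of finite index.
\<close>

section \<open>Subgroups of finite index\<close>

text \<open>
  Each coset of the preimage is the preimage of a coset of \<open>H\<close>, so there are at most as many of
  them.
\<close>

lemma finite_index_subgroup_preimage:
  assumes "group G" and "group K" and h: "h \<in> hom G K" and H: "finite_index_subgroup H K"
  shows "finite_index_subgroup {x \<in> carrier G. h x \<in> H} G"
proof -
  interpret h: group_hom G K h
    using assms by (simp add: group_hom_def group_hom_axioms_def)
  have HK: "subgroup H K" and fin: "finite (rcosets\<^bsub>K\<^esub> H)"
    using H by (auto simp: finite_index_subgroup_def)
  let ?N = "{x \<in> carrier G. h x \<in> H}"
  have N: "subgroup ?N G"
  proof (rule h.G.subgroupI)
    show "?N \<noteq> {}" using subgroup.one_closed[OF HK] h.hom_one h.G.one_closed by force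
  qed (simp_all add: subset_iff subgroup.m_closed[OF HK] subgroup.m_inv_closed[OF HK])
  have coset: "?N #>\<^bsub>G\<^esub> x = {y \<in> carrier G. h y \<in> H #>\<^bsub>K\<^esub> h x}" if x: "x \<in> carrier G" for x
  proof -
    have "y \<in> ?N #>\<^bsub>G\<^esub> x \<longleftrightarrow> h y \<in> H #>\<^bsub>K\<^esub> h x" if "y \<in> carrier G" for y
      using subgroup.rcos_module[OF N h.G.is_group x that]
        subgroup.rcos_module[OF HK h.H.is_group, of "h x" "h y"] x that by simp
    moreover have "?N #>\<^bsub>G\<^esub> x \<subseteq> carrier G"
      using h.G.r_coset_subset_G[OF subgroup.subset[OF N] x] .
    ultimately show ?thesis by blast
  qed
  have "rcosets\<^bsub>G\<^esub> ?N \<subseteq> (\<lambda>Y. {y \<in> carrier G. h y \<in> Y}) ` (rcosets\<^bsub>K\<^esub> H)"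
  proof
    fix Y assume "Y \<in> rcosets\<^bsub>G\<^esub> ?N"
    then obtain x where x: "x \<in> carrier G" "Y = ?N #>\<^bsub>G\<^esub> x"
      by (auto simp: RCOSETS_def)
    have "H #>\<^bsub>K\<^esub> h x \<in> rcosets\<^bsub>K\<^esub> H"
      using x h.H.rcosetsI[OF subgroup.subset[OF HK]] by simp
    then show "Y \<in> (\<lambda>Y. {y \<in> carrier G. h y \<in> Y}) ` (rcosets\<^bsub>K\<^esub> H)"
      using coset[OF x(1)] x(2) by blast
  qed
  then show ?thesis
    using N fin finite_surj unfolding finite_index_subgroup_def by blast
qed

text \<open>A coset of a product of subgroups is a product of cosets, and \<open>V\<close> is finite.\<close>

lemma finite_index_subgroup_product:
  assumes fin: "finite V" and G: "\<And>v. v \<in> V \<Longrightarrow> group (G v)"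
    and H: "\<And>v. v \<in> V \<Longrightarrow> finite_index_subgroup (H v) (G v)"
  shows "finite_index_subgroup (PiE V H) (product_group V G)"
proof -
  let ?P = "product_group V G"
  have P: "group ?P" using G by (rule product_group)
  have HG: "subgroup (H v) (G v)" if "v \<in> V" for v
    using H[OF that] by (simp add: finite_index_subgroup_def)
  have sub: "subgroup (PiE V H) ?P"
    using HG G by (simp add: PiE_subgroup_product_group)
  have coset: "PiE V H #>\<^bsub>?P\<^esub> x = PiE V (\<lambda>v. H v #>\<^bsub>G v\<^esub> x v)"
    if x: "x \<in> carrier ?P" for x
  proof -
    have xv: "x v \<in> carrier (G v)" if "v \<in> V" for v using x that by (auto simp: PiE_iff)
    have cv: "H v #>\<^bsub>G v\<^esub> x v \<subseteq> carrier (G v)" if "v \<in> V" for v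
      using monoid.r_coset_subset_G[OF group.is_monoid[OF G[OF that]] subgroup.subset[OF HG[OF that]] xv[OF that]] .
    have "y \<in> PiE V H #>\<^bsub>?P\<^esub> x \<longleftrightarrow> y \<in> PiE V (\<lambda>v. H v #>\<^bsub>G v\<^esub> x v)"
      if y: "y \<in> carrier ?P" for y
    proof -
      have yv: "y v \<in> carrier (G v)" if "v \<in> V" for v using y that by (auto simp: PiE_iff)
      have "y \<in> PiE V H #>\<^bsub>?P\<^esub> x \<longleftrightarrow> y \<otimes>\<^bsub>?P\<^esub> inv\<^bsub>?P\<^esub> x \<in> PiE V H"
        using subgroup.rcos_module[OF sub P x y] .
      also have "\<dots> \<longleftrightarrow> (\<forall>v\<in>V. y v \<otimes>\<^bsub>G v\<^esub> inv\<^bsub>G v\<^esub> x v \<in> H v)"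
        using inv_product_group[OF x[simplified] G] by (simp add: PiE_iff)
      also have "\<dots> \<longleftrightarrow> y \<in> PiE V (\<lambda>v. H v #>\<^bsub>G v\<^esub> x v)"
        using y subgroup.rcos_module[OF HG G xv yv] by (auto simp: PiE_iff)
      finally show ?thesis .
    qed
    moreover have "PiE V H #>\<^bsub>?P\<^esub> x \<subseteq> carrier ?P"
      using monoid.r_coset_subset_G[OF group.is_monoid[OF P] subgroup.subset[OF sub] x] .
    moreover have "PiE V (\<lambda>v. H v #>\<^bsub>G v\<^esub> x v) \<subseteq> carrier ?P"
      using cv by (auto simp: PiE_iff)
    ultimately show ?thesis by blast
  qed
  have "rcosets\<^bsub>?P\<^esub> (PiE V H) \<subseteq> PiE V ` PiE V (\<lambda>v. rcosets\<^bsub>G v\<^esub> (H v))"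
  proof
    fix Y assume "Y \<in> rcosets\<^bsub>?P\<^esub> (PiE V H)"
    then obtain x where x: "x \<in> carrier ?P" "Y = PiE V H #>\<^bsub>?P\<^esub> x"
      by (auto simp: RCOSETS_def)
    have "Y = PiE V (\<lambda>v\<in>V. H v #>\<^bsub>G v\<^esub> x v)"
      using coset[OF x(1)] x(2) by (simp cong: PiE_cong)
    moreover have "(\<lambda>v\<in>V. H v #>\<^bsub>G v\<^esub> x v) \<in> PiE V (\<lambda>v. rcosets\<^bsub>G v\<^esub> (H v))"
      using x(1) by (auto simp: RCOSETS_def PiE_iff)
    ultimately show "Y \<in> PiE V ` PiE V (\<lambda>v. rcosets\<^bsub>G v\<^esub> (H v))" by blast
  qed
  moreover have "finite (PiE V (\<lambda>v. rcosets\<^bsub>G v\<^esub> (H v)))"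
    using fin H by (auto intro!: finite_PiE simp: finite_index_subgroup_def)
  ultimately show ?thesis
    using sub finite_surj unfolding finite_index_subgroup_def by blast
qed

section \<open>Cocycles on a colimit of subgroups\<close>

text \<open>
  The cocycles see a graph product only as the colimit of a family of subgroups \<open>B i\<close> of one
  group \<open>P\<close>, with the inclusions as transition maps.  The least
  member \<open>B b\<close> plays the role of the product of the \<open>A v\<close>, that is, of the stabiliser of the base
  point.
\<close>

locale subgroup_diagram = P: group P
  for I :: "'i set" and leq :: "'i \<Rightarrow> 'i \<Rightarrow> bool" and P :: "('p, 'x) monoid_scheme"
    and B :: "'i \<Rightarrow> 'p set" and b :: 'i +
  assumes B: "i \<in> I \<Longrightarrow> subgroup (B i) P"
    and B_mono: "i \<in> I \<Longrightarrow> j \<in> I \<Longrightarrow> leq i j \<Longrightarrow> B i \<subseteq> B j"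
    and b: "b \<in> I" and b_least: "i \<in> I \<Longrightarrow> leq b i"
begin

sublocale group_diagram I leq "\<lambda>i. P\<lparr>carrier := B i\<rparr>" "\<lambda>i j x. x"
proof (rule group_diagram.intro)
  show "group (P\<lparr>carrier := B i\<rparr>)" if "i \<in> I" for i
    using B[OF that] P.is_group by (rule subgroup.subgroup_is_group)
  show "(\<lambda>x. x) \<in> hom (P\<lparr>carrier := B i\<rparr>) (P\<lparr>carrier := B j\<rparr>)"
    if "i \<in> I" "j \<in> I" "leq i j" for i j
    using B_mono[OF that] by (auto simp: hom_def)
qed

sublocale C: group C by (rule group_colimit_group)

lemma B_carrier: "i \<in> I \<Longrightarrow> g \<in> B i \<Longrightarrow> g \<in> carrier P"
  using subgroup.mem_carrier[OF B] .

lemma B_least: "i \<in> I \<Longrightarrow> a \<in> B b \<Longrightarrow> a \<in> B i"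
  using B_mono[OF b _ b_least] by blast

lemma cinj_closed: "i \<in> I \<Longrightarrow> g \<in> B i \<Longrightarrow> cinj i g \<in> carrier C"
  using hom_in_carrier[OF colimit_inj_hom] by fastforce

lemma cinj_mult:
  "i \<in> I \<Longrightarrow> g \<in> B i \<Longrightarrow> g' \<in> B i \<Longrightarrow> cinj i (g \<otimes>\<^bsub>P\<^esub> g') = cinj i g \<otimes>\<^bsub>C\<^esub> cinj i g'"
  using hom_mult[OF colimit_inj_hom, of i g g'] by simp

lemma cinj_one: "i \<in> I \<Longrightarrow> cinj i \<one>\<^bsub>P\<^esub> = \<one>\<^bsub>C\<^esub>"
  using hom_one[OF colimit_inj_hom group_D group_colimit_group, of i] by simp

lemma cinj_inv: "i \<in> I \<Longrightarrow> g \<in> B i \<Longrightarrow> cinj i (inv\<^bsub>P\<^esub> g) = inv\<^bsub>C\<^esub> cinj i g"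
  using cinj_mult[of i "inv\<^bsub>P\<^esub> g" g] cinj_one[of i] B_carrier[of i g]
    subgroup.m_inv_closed[OF B, of i g]
  by (simp add: cinj_closed C.inv_equality)

lemma cinj_least: "i \<in> I \<Longrightarrow> a \<in> B b \<Longrightarrow> cinj i a = cinj b a"
  using colimit_inj_compat[OF b _ b_least, of i a] by simp

lemma cls_Cons:
  "i \<in> I \<Longrightarrow> g \<in> B i \<Longrightarrow> w \<in> W \<Longrightarrow> cls ((i, g) # w) = cinj i g \<otimes>\<^bsub>C\<^esub> cls w"
  using mult_C[OF word_single, of i g w] by (simp add: colimit_inj_def)

lemma colimit_induct [consumes 1, case_names one mult]:
  assumes "c \<in> carrier C" and "Q \<one>\<^bsub>C\<^esub>"
    and step: "\<And>i g c. i \<in> I \<Longrightarrow> g \<in> B i \<Longrightarrow> c \<in> carrier C \<Longrightarrow> Q c \<Longrightarrow> Q (cinj i g \<otimes>\<^bsub>C\<^esub> c)"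
  shows "Q c"
proof -
  have "Q (cls w)" if "w \<in> W" for w
    using that
  proof (induction w)
    case Nil
    then show ?case using assms(2) by (simp add: one_C)
  next
    case (Cons p w)
    obtain i g where p: "p = (i, g)" by (cases p)
    have "i \<in> I" "g \<in> B i" "w \<in> W" using Cons.prems by (auto simp: diagram_words_def p)
    then show ?case
      using step[of i g "cls w"] Cons.IH by (simp add: p cls_Cons carrier_C)
  qed
  then show ?thesis using assms(1) by (auto simp: carrier_C)
qed

text \<open>
  The inclusions of the \<open>B i\<close> into \<open>P\<close> induce a homomorphism on the colimit; it reads off the end
  point of the path described by a word.
\<close>

definition proj :: "('i \<times> 'p) list set \<Rightarrow> 'p"
  where "proj = (SOME \<pi>. \<pi> \<in> hom C P \<and> (\<forall>i\<in>I. \<forall>g\<in>B i. \<pi> (cinj i g) = g))"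

lemma proj: "proj \<in> hom C P" "i \<in> I \<Longrightarrow> g \<in> B i \<Longrightarrow> proj (cinj i g) = g"
proof -
  have "(\<lambda>x. x) \<in> hom (P\<lparr>carrier := B i\<rparr>) P" if "i \<in> I" for i
    using B_carrier[OF that] by (simp add: hom_def)
  then have "\<exists>\<pi>. \<pi> \<in> hom C P \<and> (\<forall>i\<in>I. \<forall>g\<in>B i. \<pi> (cinj i g) = g)"
    using group_colimit_universal[OF P.is_group, of "\<lambda>i x. x"] by simp blast
  then have "proj \<in> hom C P \<and> (\<forall>i\<in>I. \<forall>g\<in>B i. proj (cinj i g) = g)"
    unfolding proj_def by (rule someI_ex)
  then show "proj \<in> hom C P" "i \<in> I \<Longrightarrow> g \<in> B i \<Longrightarrow> proj (cinj i g) = g" by blast+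
qed

sublocale proj: group_hom C P proj
  by unfold_locales (rule proj(1))

end

text \<open>
  The map \<open>\<sigma>\<close> sends each coset \<open>k B i\<close> into the coset \<open>(\<sigma> k) B' i\<close>.  It acts on the points of
  paths, not on their letters: the element \<open>step k g\<close> below is the letter that leads from \<open>\<sigma> k\<close>
  to \<open>\<sigma> (k g)\<close>.
\<close>

locale coset_lift = src: subgroup_diagram I leq P B b + tgt: subgroup_diagram I leq P' B' b
  for I :: "'i set" and leq :: "'i \<Rightarrow> 'i \<Rightarrow> bool"
    and P :: "('p, 'x) monoid_scheme" and B :: "'i \<Rightarrow> 'p set"
    and P' :: "('q, 'y) monoid_scheme" and B' :: "'i \<Rightarrow> 'q set" and b :: 'i +
  fixes \<sigma> :: "'p \<Rightarrow> 'q"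
  assumes \<sigma>_closed: "k \<in> carrier P \<Longrightarrow> \<sigma> k \<in> carrier P'"
    and \<sigma>_step: "i \<in> I \<Longrightarrow> k \<in> carrier P \<Longrightarrow> g \<in> B i \<Longrightarrow>
      inv\<^bsub>P'\<^esub> \<sigma> k \<otimes>\<^bsub>P'\<^esub> \<sigma> (k \<otimes>\<^bsub>P\<^esub> g) \<in> B' i"
begin

abbreviation step :: "'p \<Rightarrow> 'p \<Rightarrow> 'q"
  where "step k g \<equiv> inv\<^bsub>P'\<^esub> \<sigma> k \<otimes>\<^bsub>P'\<^esub> \<sigma> (k \<otimes>\<^bsub>P\<^esub> g)"

text \<open>
  Going from \<open>k\<close> to \<open>k g g'\<close> directly or through \<open>k g\<close> amounts to the same.  This is why the
  multiplication relations of the colimit are respected.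
\<close>

lemma step_mult:
  assumes "k \<in> carrier P" "g \<in> carrier P" "g' \<in> carrier P"
  shows "step k (g \<otimes>\<^bsub>P\<^esub> g') = step k g \<otimes>\<^bsub>P'\<^esub> step (k \<otimes>\<^bsub>P\<^esub> g) g'"
proof -
  have "step k g \<otimes>\<^bsub>P'\<^esub> step (k \<otimes>\<^bsub>P\<^esub> g) g'
      = inv\<^bsub>P'\<^esub> \<sigma> k \<otimes>\<^bsub>P'\<^esub> (\<sigma> (k \<otimes>\<^bsub>P\<^esub> g) \<otimes>\<^bsub>P'\<^esub> (inv\<^bsub>P'\<^esub> \<sigma> (k \<otimes>\<^bsub>P\<^esub> g)
          \<otimes>\<^bsub>P'\<^esub> \<sigma> (k \<otimes>\<^bsub>P\<^esub> g \<otimes>\<^bsub>P\<^esub> g')))"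
    using assms \<sigma>_closed by (simp add: tgt.P.m_assoc)
  also have "\<dots> = step k (g \<otimes>\<^bsub>P\<^esub> g')"
    using assms \<sigma>_closed by (simp add: tgt.P.m_assoc[symmetric]) (simp add: src.P.m_assoc)
  finally show ?thesis ..
qed

fun word_cocycle :: "'p \<Rightarrow> ('i \<times> 'p) list \<Rightarrow> ('i \<times> 'q) list set"
  where
    "word_cocycle k [] = \<one>\<^bsub>tgt.C\<^esub>"
  | "word_cocycle k ((i, g) # w) =
      tgt.cinj i (step k g) \<otimes>\<^bsub>tgt.C\<^esub> word_cocycle (k \<otimes>\<^bsub>P\<^esub> g) w"

lemma word_cocycle_closed:
  "w \<in> src.W \<Longrightarrow> k \<in> carrier P \<Longrightarrow> word_cocycle k w \<in> carrier tgt.C"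
proof (induction w arbitrary: k)
  case (Cons p w)
  obtain i g where p: "p = (i, g)" by (cases p)
  have "i \<in> I" "g \<in> B i" "w \<in> src.W" using Cons.prems by (auto simp: diagram_words_def p)
  then show ?case
    using Cons src.B_carrier by (simp add: p tgt.cinj_closed \<sigma>_step)
qed simp

text \<open>The second part of the path begins where the first part ends.\<close>

lemma word_cocycle_append:
  "u \<in> src.W \<Longrightarrow> w \<in> src.W \<Longrightarrow> k \<in> carrier P \<Longrightarrow>
    word_cocycle k (u @ w) =
      word_cocycle k u \<otimes>\<^bsub>tgt.C\<^esub> word_cocycle (k \<otimes>\<^bsub>P\<^esub> src.proj (src.cls u)) w"
proof (induction u arbitrary: k)
  case Nil
  then show ?case using word_cocycle_closed by (simp flip: src.one_C)
next
  case (Cons p u)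
  obtain i g where p: "p = (i, g)" by (cases p)
  have *: "i \<in> I" "g \<in> B i" "u \<in> src.W" using Cons.prems by (auto simp: diagram_words_def p)
  have g: "g \<in> carrier P" using * src.B_carrier by blast
  have u: "src.cls u \<in> carrier src.C" using * by (simp add: src.carrier_C)
  have "src.proj (src.cls (p # u)) = g \<otimes>\<^bsub>P\<^esub> src.proj (src.cls u)"
    using * u by (simp add: p src.cls_Cons src.cinj_closed src.proj)
  then show ?case
    using Cons * g u
    by (simp add: p word_cocycle_closed tgt.cinj_closed \<sigma>_step tgt.C.m_assoc src.P.m_assoc)
qed

text \<open>
  The induction has to be over all starting points \<open>k\<close> at once, since the second part of a word is
  read from the end point of the first.  That end point only depends on the class of the first
  part.
\<close>

lemma word_cocycle_ceq:
  "src.ceq u w \<Longrightarrow> k \<in> carrier P \<Longrightarrow> word_cocycle k u = word_cocycle k w"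
proof (induction arbitrary: k rule: colimit_eq.induct)
  case (ceq_append u u' w w')
  have "src.cls u = src.cls u'"
    using ceq_append(1) src.ceq_words src.cls_eq_iff by blast
  then show ?case
    using ceq_append src.ceq_words[OF ceq_append(1)] src.ceq_words[OF ceq_append(2)]
    by (simp add: word_cocycle_append src.carrier_C)
next
  case (ceq_one i)
  then show ?case by (simp add: \<sigma>_closed tgt.cinj_one)
next
  case (ceq_mult i x y)
  then have *: "x \<in> carrier P" "y \<in> carrier P" "x \<in> B i" "y \<in> B i"
    using src.B_carrier by auto
  have "tgt.cinj i (step k (x \<otimes>\<^bsub>P\<^esub> y)) =
      tgt.cinj i (step k x) \<otimes>\<^bsub>tgt.C\<^esub> tgt.cinj i (step (k \<otimes>\<^bsub>P\<^esub> x) y)"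
    using * ceq_mult \<sigma>_step
    by (simp only: step_mult src.P.m_closed tgt.cinj_mult)
  then show ?case
    using * ceq_mult \<sigma>_step by (simp add: tgt.cinj_closed)
next
  case (ceq_map i j x)
  then have "step k x \<in> B' i" using \<sigma>_step by simp
  then show ?case using ceq_map tgt.colimit_inj_compat[of i j "step k x"] by simp
qed auto

definition cocycle :: "'p \<Rightarrow> ('i \<times> 'p) list set \<Rightarrow> ('i \<times> 'q) list set"
  where "cocycle k c = word_cocycle k (SOME w. w \<in> c)"

lemma cocycle_cls: "w \<in> src.W \<Longrightarrow> k \<in> carrier P \<Longrightarrow> cocycle k (src.cls w) = word_cocycle k w"
proof -
  assume w: "w \<in> src.W" and k: "k \<in> carrier P"
  have "w \<in> src.cls w" using w by (simp add: colimit_class_def ceq_refl)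
  then have "(SOME w'. w' \<in> src.cls w) \<in> src.cls w" by (rule someI)
  then show ?thesis
    using word_cocycle_ceq[OF _ k] by (simp add: cocycle_def colimit_class_def)
qed

lemma cocycle_closed:
  "c \<in> carrier src.C \<Longrightarrow> k \<in> carrier P \<Longrightarrow> cocycle k c \<in> carrier tgt.C"
  by (auto simp: src.carrier_C cocycle_cls word_cocycle_closed)

lemma cocycle_one: "k \<in> carrier P \<Longrightarrow> cocycle k \<one>\<^bsub>src.C\<^esub> = \<one>\<^bsub>tgt.C\<^esub>"
  by (simp add: src.one_C cocycle_cls src.word_Nil)

lemma cocycle_cinj:
  "i \<in> I \<Longrightarrow> g \<in> B i \<Longrightarrow> k \<in> carrier P \<Longrightarrow>
    cocycle k (src.cinj i g) = tgt.cinj i (step k g)"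
  using \<sigma>_step by (simp add: colimit_inj_def[of I leq _ _ i g] cocycle_cls src.word_single tgt.cinj_closed)

lemma cocycle_mult:
  "c \<in> carrier src.C \<Longrightarrow> d \<in> carrier src.C \<Longrightarrow> k \<in> carrier P \<Longrightarrow>
    cocycle k (c \<otimes>\<^bsub>src.C\<^esub> d) = cocycle k c \<otimes>\<^bsub>tgt.C\<^esub> cocycle (k \<otimes>\<^bsub>P\<^esub> src.proj c) d"
  by (auto simp: src.carrier_C src.mult_C src.word_append cocycle_cls word_cocycle_append
      src.proj.hom_closed)

lemma proj_cocycle:
  "c \<in> carrier src.C \<Longrightarrow> k \<in> carrier P \<Longrightarrow> tgt.proj (cocycle k c) = step k (src.proj c)"
proof (induction arbitrary: k rule: src.colimit_induct)
  case one
  then show ?case by (simp add: cocycle_one \<sigma>_closed)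
next
  case (mult i g c)
  then show ?case
    using src.B_carrier[of i g]
    by (simp add: cocycle_mult cocycle_cinj cocycle_closed src.proj tgt.proj src.cinj_closed
        tgt.cinj_closed \<sigma>_step step_mult)
qed

text \<open>
  With \<open>a k = k\<^sup>-\<^sup>1 \<tau> (\<sigma> k)\<close>, the letter \<open>g\<close> read at \<open>k\<close> is carried back and forth to
  \<open>(\<tau> (\<sigma> k))\<^sup>-\<^sup>1 \<tau> (\<sigma> (k g)) = (a k)\<^sup>-\<^sup>1 g (a (k g))\<close>.  The factors \<open>a\<close> lie in \<open>B b\<close>, so their images
  in the colimit are the same from every \<open>B i\<close>, and along a word they cancel except at the two
  ends.
\<close>

lemma cocycle_cocycle:
  assumes opp: "coset_lift I leq P' B' P B b \<tau>"
    and \<tau>\<sigma>: "\<And>k. k \<in> carrier P \<Longrightarrow> inv\<^bsub>P\<^esub> k \<otimes>\<^bsub>P\<^esub> \<tau> (\<sigma> k) \<in> B b"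
    and c: "c \<in> carrier src.C" and k: "k \<in> carrier P"
  shows "coset_lift.cocycle I leq P' P B \<tau> (\<sigma> k) (cocycle k c) =
    inv\<^bsub>src.C\<^esub> src.cinj b (inv\<^bsub>P\<^esub> k \<otimes>\<^bsub>P\<^esub> \<tau> (\<sigma> k)) \<otimes>\<^bsub>src.C\<^esub> c \<otimes>\<^bsub>src.C\<^esub>
      src.cinj b (inv\<^bsub>P\<^esub> (k \<otimes>\<^bsub>P\<^esub> src.proj c) \<otimes>\<^bsub>P\<^esub> \<tau> (\<sigma> (k \<otimes>\<^bsub>P\<^esub> src.proj c)))"
proof -
  interpret opp: coset_lift I leq P' B' P B b \<tau> by (rule opp)
  define a where "a k = inv\<^bsub>P\<^esub> k \<otimes>\<^bsub>P\<^esub> \<tau> (\<sigma> k)" for k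
  have a: "a k \<in> B b" if "k \<in> carrier P" for k
    using \<tau>\<sigma>[OF that] by (simp add: a_def)
  have aC: "src.cinj b (a k) \<in> carrier src.C" if "k \<in> carrier P" for k
    using a[OF that] src.b by (simp add: src.cinj_closed)
  have \<tau>\<sigma>_eq: "\<tau> (\<sigma> k) = k \<otimes>\<^bsub>P\<^esub> a k" if "k \<in> carrier P" for k
    using that \<sigma>_closed opp.\<sigma>_closed by (simp add: a_def flip: src.P.m_assoc)
  have "opp.cocycle (\<sigma> k) (cocycle k c) =
      inv\<^bsub>src.C\<^esub> src.cinj b (a k) \<otimes>\<^bsub>src.C\<^esub> c \<otimes>\<^bsub>src.C\<^esub> src.cinj b (a (k \<otimes>\<^bsub>P\<^esub> src.proj c))"
    using c k
  proof (induction arbitrary: k rule: src.colimit_induct)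
    case one
    then show ?case by (simp add: cocycle_one opp.cocycle_one \<sigma>_closed aC)
  next
    case (mult i g c)
    have g: "g \<in> carrier P" using mult src.B_carrier by blast
    have \<sigma>kg: "\<sigma> k \<otimes>\<^bsub>P'\<^esub> step k g = \<sigma> (k \<otimes>\<^bsub>P\<^esub> g)"
      using mult.prems g \<sigma>_closed by (simp flip: tgt.P.m_assoc)
    have ai: "a k \<in> B i" "a (k \<otimes>\<^bsub>P\<^esub> g) \<in> B i" "inv\<^bsub>P\<^esub> a k \<in> B i"
      using a mult g src.B_least subgroup.m_inv_closed[OF src.B] by auto
    have aP: "a k \<in> carrier P" "a (k \<otimes>\<^bsub>P\<^esub> g) \<in> carrier P"
      using ai mult src.B_carrier by auto
    have "inv\<^bsub>P\<^esub> \<tau> (\<sigma> k) \<otimes>\<^bsub>P\<^esub> \<tau> (\<sigma> (k \<otimes>\<^bsub>P\<^esub> g)) =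
        inv\<^bsub>P\<^esub> a k \<otimes>\<^bsub>P\<^esub> (inv\<^bsub>P\<^esub> k \<otimes>\<^bsub>P\<^esub> (k \<otimes>\<^bsub>P\<^esub> (g \<otimes>\<^bsub>P\<^esub> a (k \<otimes>\<^bsub>P\<^esub> g))))"
      using mult.prems g aP by (simp add: \<tau>\<sigma>_eq src.P.inv_mult_group src.P.m_assoc)
    also have "\<dots> = inv\<^bsub>P\<^esub> a k \<otimes>\<^bsub>P\<^esub> (g \<otimes>\<^bsub>P\<^esub> a (k \<otimes>\<^bsub>P\<^esub> g))"
      using mult.prems g aP by (simp flip: src.P.m_assoc)
    finally have "src.cinj i (inv\<^bsub>P\<^esub> \<tau> (\<sigma> k) \<otimes>\<^bsub>P\<^esub> \<tau> (\<sigma> (k \<otimes>\<^bsub>P\<^esub> g))) =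
        inv\<^bsub>src.C\<^esub> src.cinj b (a k) \<otimes>\<^bsub>src.C\<^esub>
          (src.cinj i g \<otimes>\<^bsub>src.C\<^esub> src.cinj b (a (k \<otimes>\<^bsub>P\<^esub> g)))"
      using mult.hyps mult.prems g ai a subgroup.m_closed[OF src.B]
      by (simp add: src.cinj_mult src.cinj_inv src.cinj_least)
    moreover have "opp.cocycle (\<sigma> k) (tgt.cinj i (step k g)) =
        src.cinj i (inv\<^bsub>P\<^esub> \<tau> (\<sigma> k) \<otimes>\<^bsub>P\<^esub> \<tau> (\<sigma> (k \<otimes>\<^bsub>P\<^esub> g)))"
      using mult \<sigma>_step \<sigma>kg by (simp add: opp.cocycle_cinj \<sigma>_closed)
    moreover have "opp.cocycle (\<sigma> k) (cocycle k (src.cinj i g \<otimes>\<^bsub>src.C\<^esub> c)) =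
        opp.cocycle (\<sigma> k) (tgt.cinj i (step k g)) \<otimes>\<^bsub>src.C\<^esub>
          opp.cocycle (\<sigma> (k \<otimes>\<^bsub>P\<^esub> g)) (cocycle (k \<otimes>\<^bsub>P\<^esub> g) c)"
      using mult \<sigma>_step \<sigma>kg g
      by (simp add: cocycle_mult cocycle_cinj src.cinj_closed src.proj tgt.cinj_closed
          cocycle_closed opp.cocycle_mult tgt.proj \<sigma>_closed)
    ultimately have eq: "opp.cocycle (\<sigma> k) (cocycle k (src.cinj i g \<otimes>\<^bsub>src.C\<^esub> c)) =
        inv\<^bsub>src.C\<^esub> src.cinj b (a k) \<otimes>\<^bsub>src.C\<^esub>
          (src.cinj i g \<otimes>\<^bsub>src.C\<^esub> src.cinj b (a (k \<otimes>\<^bsub>P\<^esub> g))) \<otimes>\<^bsub>src.C\<^esub>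
        (inv\<^bsub>src.C\<^esub> src.cinj b (a (k \<otimes>\<^bsub>P\<^esub> g)) \<otimes>\<^bsub>src.C\<^esub> c \<otimes>\<^bsub>src.C\<^esub>
          src.cinj b (a (k \<otimes>\<^bsub>P\<^esub> g \<otimes>\<^bsub>P\<^esub> src.proj c)))"
      using mult.IH mult.prems g by simp
    \<comment> \<open>The factor left at the end of the letter meets its inverse at the start of the rest.\<close>
    have cancel: "x \<otimes>\<^bsub>src.C\<^esub> (inv\<^bsub>src.C\<^esub> x \<otimes>\<^bsub>src.C\<^esub> y) = y"
      if "x \<in> carrier src.C" "y \<in> carrier src.C" for x y
      using that by (simp flip: src.C.m_assoc)
    have "src.proj (src.cinj i g \<otimes>\<^bsub>src.C\<^esub> c) = g \<otimes>\<^bsub>P\<^esub> src.proj c"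
      using mult by (simp add: src.cinj_closed src.proj)
    then show ?case
      using mult.hyps mult.prems g
      by (simp add: eq src.cinj_closed aC src.C.m_assoc src.P.m_assoc cancel)
  qed
  then show ?thesis by (simp add: a_def)
qed

end

text \<open>
  The equivariance is phrased without a separate isomorphism from \<open>H\<close> to \<open>H'\<close>: the case
  of \<open>k\<close> in \<open>H\<close> says that \<open>\<sigma>\<close> itself is a homomorphism on \<open>H\<close>.  In particular \<open>\<sigma>\<close> preserves the
  base point \<open>1\<close>.
\<close>

locale equivariant_coset_lift = coset_lift I leq P B P' B' b \<sigma>
  for I :: "'i set" and leq :: "'i \<Rightarrow> 'i \<Rightarrow> bool"
    and P :: "('p, 'x) monoid_scheme" and B :: "'i \<Rightarrow> 'p set"
    and P' :: "('q, 'y) monoid_scheme" and B' :: "'i \<Rightarrow> 'q set" and b :: 'i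
    and \<sigma> :: "'p \<Rightarrow> 'q" +
  fixes H :: "'p set" and H' :: "'q set"
  assumes H: "subgroup H P"
    and \<sigma>_H: "h \<in> H \<Longrightarrow> \<sigma> h \<in> H'"
    and \<sigma>_equivariant: "h \<in> H \<Longrightarrow> k \<in> carrier P \<Longrightarrow> \<sigma> (h \<otimes>\<^bsub>P\<^esub> k) = \<sigma> h \<otimes>\<^bsub>P'\<^esub> \<sigma> k"
begin

lemma H_carrier: "h \<in> H \<Longrightarrow> h \<in> carrier P"
  using subgroup.mem_carrier[OF H] .

lemma \<sigma>_one: "\<sigma> \<one>\<^bsub>P\<^esub> = \<one>\<^bsub>P'\<^esub>"
  using \<sigma>_equivariant[of "\<one>\<^bsub>P\<^esub>" "\<one>\<^bsub>P\<^esub>"] subgroup.one_closed[OF H] \<sigma>_closed[of "\<one>\<^bsub>P\<^esub>"]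
  by simp

lemma step_equivariant:
  assumes "h \<in> H" "k \<in> carrier P" "g \<in> carrier P"
  shows "step (h \<otimes>\<^bsub>P\<^esub> k) g = step k g"
proof -
  have "step (h \<otimes>\<^bsub>P\<^esub> k) g = inv\<^bsub>P'\<^esub> (\<sigma> h \<otimes>\<^bsub>P'\<^esub> \<sigma> k) \<otimes>\<^bsub>P'\<^esub> (\<sigma> h \<otimes>\<^bsub>P'\<^esub> \<sigma> (k \<otimes>\<^bsub>P\<^esub> g))"
    using assms H_carrier by (simp add: \<sigma>_equivariant src.P.m_assoc)
  also have "\<dots> = inv\<^bsub>P'\<^esub> \<sigma> k \<otimes>\<^bsub>P'\<^esub> (inv\<^bsub>P'\<^esub> \<sigma> h \<otimes>\<^bsub>P'\<^esub> (\<sigma> h \<otimes>\<^bsub>P'\<^esub> \<sigma> (k \<otimes>\<^bsub>P\<^esub> g)))"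
    using assms H_carrier \<sigma>_closed by (simp add: tgt.P.inv_mult_group tgt.P.m_assoc)
  also have "\<dots> = step k g"
    using assms H_carrier \<sigma>_closed by (simp flip: tgt.P.m_assoc)
  finally show ?thesis .
qed

lemma cocycle_equivariant:
  "c \<in> carrier src.C \<Longrightarrow> h \<in> H \<Longrightarrow> k \<in> carrier P \<Longrightarrow>
    cocycle (h \<otimes>\<^bsub>P\<^esub> k) c = cocycle k c"
proof (induction arbitrary: k rule: src.colimit_induct)
  case one
  then show ?case using H_carrier by (simp add: cocycle_one)
next
  case (mult i g c)
  then have "g \<in> carrier P" "h \<in> carrier P" using src.B_carrier H_carrier by auto
  with mult show ?case
    using step_equivariant[of h k g]
    by (simp add: cocycle_mult cocycle_cinj src.proj src.cinj_closed src.P.m_assoc)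
qed

abbreviation "K \<equiv> {c \<in> carrier src.C. src.proj c \<in> H}"
abbreviation "K' \<equiv> {c \<in> carrier tgt.C. tgt.proj c \<in> H'}"

text \<open>
  The second factor of a product \<open>c d\<close> in \<open>K\<close> is read from \<open>proj c\<close>, an element of \<open>H\<close>, and thus
  as if it were read from \<open>1\<close>.
\<close>

lemma cocycle_hom: "cocycle \<one>\<^bsub>P\<^esub> \<in> hom (src.C\<lparr>carrier := K\<rparr>) (tgt.C\<lparr>carrier := K'\<rparr>)"
proof (rule homI)
  fix c assume "c \<in> carrier (src.C\<lparr>carrier := K\<rparr>)"
  then show "cocycle \<one>\<^bsub>P\<^esub> c \<in> carrier (tgt.C\<lparr>carrier := K'\<rparr>)"
    using \<sigma>_H H_carrier by (simp add: cocycle_closed proj_cocycle \<sigma>_one \<sigma>_closed)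
next
  fix c d assume *: "c \<in> carrier (src.C\<lparr>carrier := K\<rparr>)" "d \<in> carrier (src.C\<lparr>carrier := K\<rparr>)"
  have "cocycle (src.proj c) d = cocycle \<one>\<^bsub>P\<^esub> d"
    using cocycle_equivariant[of d "src.proj c" "\<one>\<^bsub>P\<^esub>"] * by simp
  then show "cocycle \<one>\<^bsub>P\<^esub> (c \<otimes>\<^bsub>src.C\<lparr>carrier := K\<rparr>\<^esub> d) =
      cocycle \<one>\<^bsub>P\<^esub> c \<otimes>\<^bsub>tgt.C\<lparr>carrier := K'\<rparr>\<^esub> cocycle \<one>\<^bsub>P\<^esub> d"
    using * by (simp add: cocycle_mult)
qed

text \<open>A path that describes an element of \<open>K\<close> has both ends in \<open>H\<close>, where \<open>\<tau> \<circ> \<sigma>\<close> is the identity.\<close>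

lemma cocycle_inverse:
  assumes opp: "coset_lift I leq P' B' P B b \<tau>"
    and \<tau>\<sigma>: "\<And>k. k \<in> carrier P \<Longrightarrow> inv\<^bsub>P\<^esub> k \<otimes>\<^bsub>P\<^esub> \<tau> (\<sigma> k) \<in> B b"
    and \<tau>\<sigma>_H: "\<And>h. h \<in> H \<Longrightarrow> \<tau> (\<sigma> h) = h"
    and c: "c \<in> K"
  shows "coset_lift.cocycle I leq P' P B \<tau> \<one>\<^bsub>P'\<^esub> (cocycle \<one>\<^bsub>P\<^esub> c) = c"
proof -
  have "\<one>\<^bsub>P\<^esub> \<in> H" using subgroup.one_closed[OF H] .
  then show ?thesis
    using cocycle_cocycle[OF opp \<tau>\<sigma>, of c "\<one>\<^bsub>P\<^esub>"] c \<tau>\<sigma>_H[of "\<one>\<^bsub>P\<^esub>"] \<tau>\<sigma>_H[of "src.proj c"]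
    by (simp add: \<sigma>_one src.cinj_one src.b H_carrier)
qed

end

theorem commensurable_colimits:
  assumes fwd: "equivariant_coset_lift I leq P B P' B' b \<sigma> H H'"
    and opp: "equivariant_coset_lift I leq P' B' P B b \<tau> H' H"
    and \<tau>\<sigma>: "\<And>k. k \<in> carrier P \<Longrightarrow> inv\<^bsub>P\<^esub> k \<otimes>\<^bsub>P\<^esub> \<tau> (\<sigma> k) \<in> B b"
    and \<sigma>\<tau>: "\<And>k. k \<in> carrier P' \<Longrightarrow> inv\<^bsub>P'\<^esub> k \<otimes>\<^bsub>P'\<^esub> \<sigma> (\<tau> k) \<in> B' b"
    and \<tau>\<sigma>_H: "\<And>h. h \<in> H \<Longrightarrow> \<tau> (\<sigma> h) = h" and \<sigma>\<tau>_H: "\<And>h. h \<in> H' \<Longrightarrow> \<sigma> (\<tau> h) = h"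
    and H: "finite_index_subgroup H P" and H': "finite_index_subgroup H' P'"
  shows "commensurable (group_colimit I leq (\<lambda>i. P\<lparr>carrier := B i\<rparr>) (\<lambda>i j x. x))
    (group_colimit I leq (\<lambda>i. P'\<lparr>carrier := B' i\<rparr>) (\<lambda>i j x. x))"
proof -
  interpret fwd: equivariant_coset_lift I leq P B P' B' b \<sigma> H H' by (rule fwd)
  interpret opp: equivariant_coset_lift I leq P' B' P B b \<tau> H' H by (rule opp)
  have K: "finite_index_subgroup fwd.K fwd.src.C"
    by (rule finite_index_subgroup_preimage[OF fwd.src.C.is_group fwd.src.P.is_group fwd.src.proj(1) H])
  have K': "finite_index_subgroup fwd.K' fwd.tgt.C"
    by (rule finite_index_subgroup_preimage[OF fwd.tgt.C.is_group fwd.tgt.P.is_group fwd.tgt.proj(1) H'])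
  have "bij_betw (fwd.cocycle \<one>\<^bsub>P\<^esub>) fwd.K fwd.K'"
  proof (rule bij_betw_byWitness[where f' = "opp.cocycle \<one>\<^bsub>P'\<^esub>"])
    show "\<forall>c\<in>fwd.K. opp.cocycle \<one>\<^bsub>P'\<^esub> (fwd.cocycle \<one>\<^bsub>P\<^esub> c) = c"
      using fwd.cocycle_inverse[OF opp.coset_lift_axioms \<tau>\<sigma> \<tau>\<sigma>_H] by blast
    show "\<forall>c\<in>fwd.K'. fwd.cocycle \<one>\<^bsub>P\<^esub> (opp.cocycle \<one>\<^bsub>P'\<^esub> c) = c"
      using opp.cocycle_inverse[OF fwd.coset_lift_axioms \<sigma>\<tau> \<sigma>\<tau>_H] by blast
    show "fwd.cocycle \<one>\<^bsub>P\<^esub> ` fwd.K \<subseteq> fwd.K'"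
      using hom_in_carrier[OF fwd.cocycle_hom] by (simp add: image_subset_iff)
    show "opp.cocycle \<one>\<^bsub>P'\<^esub> ` fwd.K' \<subseteq> fwd.K"
      using hom_in_carrier[OF opp.cocycle_hom] by (simp add: image_subset_iff)
  qed
  then have "fwd.src.C\<lparr>carrier := fwd.K\<rparr> \<cong> fwd.tgt.C\<lparr>carrier := fwd.K'\<rparr>"
    using fwd.cocycle_hom by (intro is_isoI) (simp add: iso_def)
  moreover have "group (fwd.src.C\<lparr>carrier := fwd.K\<rparr>)"
    using K fwd.src.C.is_group
    by (simp add: finite_index_subgroup_def subgroup.subgroup_is_group)
  ultimately show ?thesis
    using commensurableI[OF _ fwd.src.C.is_group K iso_refl K'] by blast
qed

section \<open>Lifting an equivariant bijection of cosets\<close>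

text \<open>
  One half of a pair of mutually inverse lifts: \<open>\<sigma>\<close> is \<open>H\<close>-equivariant and induces a map from
  \<open>G / A\<close> to \<open>G' / A'\<close>, and \<open>\<tau>\<close> is a left inverse of \<open>\<sigma>\<close> on \<open>H\<close>, but only modulo \<open>A\<close>
  elsewhere.  One cannot ask for more, as \<open>A\<close> and \<open>A'\<close> may differ in cardinality.  Membership in a
  left coset is written with inverses because the cocycles are built from these elements.
\<close>

definition equivariant_lift ::
  "('a, 'm) monoid_scheme \<Rightarrow> 'a set \<Rightarrow> 'a set \<Rightarrow> ('b, 'n) monoid_scheme \<Rightarrow> 'b set \<Rightarrow> 'b set \<Rightarrow>
    ('a \<Rightarrow> 'b) \<Rightarrow> ('b \<Rightarrow> 'a) \<Rightarrow> bool"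
  where "equivariant_lift G A H G' A' H' \<sigma> \<tau> \<longleftrightarrow>
    (\<forall>k\<in>carrier G. \<sigma> k \<in> carrier G' \<and> inv\<^bsub>G\<^esub> k \<otimes>\<^bsub>G\<^esub> \<tau> (\<sigma> k) \<in> A \<and>
      (\<forall>a\<in>A. inv\<^bsub>G'\<^esub> \<sigma> k \<otimes>\<^bsub>G'\<^esub> \<sigma> (k \<otimes>\<^bsub>G\<^esub> a) \<in> A')) \<and>
    (\<forall>h\<in>H. \<sigma> h \<in> H' \<and> \<tau> (\<sigma> h) = h \<and>
      (\<forall>k\<in>carrier G. \<sigma> (h \<otimes>\<^bsub>G\<^esub> k) = \<sigma> h \<otimes>\<^bsub>G'\<^esub> \<sigma> k))"

lemma (in group) lcos_eq_iff:
  assumes A: "subgroup A G" and "x \<in> carrier G" "y \<in> carrier G"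
  shows "x <# A = y <# A \<longleftrightarrow> inv x \<otimes> y \<in> A"
  using assms lcos_self[OF assms(3) A] l_repr_independence[OF _ assms(2) A]
    subgroup.lcos_module_imp[OF A is_group assms(2)]
    subgroup.lcos_module_rev[OF A is_group assms(2,3)]
  by metis

lemma lcosetsI: "x \<in> carrier G \<Longrightarrow> x <#\<^bsub>G\<^esub> A \<in> lcosets\<^bsub>G\<^esub> A"
  by (auto simp: LCOSETS_def)

text \<open>
  Since \<open>H\<close> acts freely on \<open>G\<close> by left multiplication, \<open>\<sigma>\<close> may be prescribed on one
  representative of each coset \<open>H k\<close>, by any element of the coset of \<open>A'\<close> that \<open>f\<close> demands, and is
  then determined by equivariance.  Choosing \<open>1\<close> to represent \<open>H\<close> and to be sent to \<open>1\<close>, which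
  is possible because \<open>f A = A'\<close>, makes \<open>\<sigma>\<close> agree with \<open>\<theta>\<close> on \<open>H\<close>.
\<close>

lemma ex_equivariant_coset_map_lift:
  assumes "group G" and "group G'" and A: "subgroup A G" and A': "subgroup A' G'"
    and H: "subgroup H G" and \<theta>: "\<theta> \<in> hom (G\<lparr>carrier := H\<rparr>) G'"
    and f: "\<And>P. P \<in> lcosets\<^bsub>G\<^esub> A \<Longrightarrow> f P \<in> lcosets\<^bsub>G'\<^esub> A'"
    and f_equivariant: "\<And>h P. h \<in> H \<Longrightarrow> P \<in> lcosets\<^bsub>G\<^esub> A \<Longrightarrow> f (h <#\<^bsub>G\<^esub> P) = \<theta> h <#\<^bsub>G'\<^esub> f P"
    and fA: "f A = A'"
  obtains \<sigma> where "\<And>k. k \<in> carrier G \<Longrightarrow> \<sigma> k \<in> carrier G'"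
    and "\<And>k. k \<in> carrier G \<Longrightarrow> \<sigma> k <#\<^bsub>G'\<^esub> A' = f (k <#\<^bsub>G\<^esub> A)"
    and "\<And>h k. h \<in> H \<Longrightarrow> k \<in> carrier G \<Longrightarrow> \<sigma> (h \<otimes>\<^bsub>G\<^esub> k) = \<theta> h \<otimes>\<^bsub>G'\<^esub> \<sigma> k"
    and "\<And>h. h \<in> H \<Longrightarrow> \<sigma> h = \<theta> h"
proof -
  interpret G: group G by fact
  interpret G': group G' by fact
  interpret H: subgroup H G by fact
  have AG: "A \<subseteq> carrier G" and A'G: "A' \<subseteq> carrier G'"
    using A A' subgroup.subset by blast+
  have \<theta>_closed: "\<theta> h \<in> carrier G'" if "h \<in> H" for h
    using hom_in_carrier[OF \<theta>] that by simp
  have \<theta>_mult: "\<theta> (h \<otimes>\<^bsub>G\<^esub> h') = \<theta> h \<otimes>\<^bsub>G'\<^esub> \<theta> h'" if "h \<in> H" "h' \<in> H" for h h'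
    using hom_mult[OF \<theta>] that by simp
  define rep where "rep k = (if k \<in> H then \<one>\<^bsub>G\<^esub> else SOME y. y \<in> H #>\<^bsub>G\<^esub> k)" for k
  have rep_coset: "rep k \<in> H #>\<^bsub>G\<^esub> k" if k: "k \<in> carrier G" for k
  proof (cases "k \<in> H")
    case True
    then show ?thesis using G.coset_join2[OF k H] by (simp add: rep_def)
  next
    case False
    then show ?thesis
      using someI[of "\<lambda>y. y \<in> H #>\<^bsub>G\<^esub> k", OF G.rcos_self[OF k H]] by (simp add: rep_def)
  qed
  have rep_closed: "rep k \<in> carrier G" if "k \<in> carrier G" for k
    using rep_coset[OF that] G.r_coset_subset_G[OF H.subset that] by blast
  have rep_H: "k \<otimes>\<^bsub>G\<^esub> inv\<^bsub>G\<^esub> rep k \<in> H" if k: "k \<in> carrier G" for k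
    using H.rcos_module_imp[OF G.is_group k rep_coset[OF k]] rep_closed[OF k] k
    by (metis G.inv_inv G.inv_closed G.inv_mult_group H.m_inv_closed)
  have rep_mult: "rep (h \<otimes>\<^bsub>G\<^esub> k) = rep k" if h: "h \<in> H" and k: "k \<in> carrier G" for h k
  proof -
    have hG: "h \<in> carrier G" using h by (rule H.mem_carrier)
    have "h \<otimes>\<^bsub>G\<^esub> k \<in> H \<longleftrightarrow> k \<in> H"
      using h k hG by (metis G.inv_solve_left G.m_closed H.m_closed H.m_inv_closed)
    moreover have "H #>\<^bsub>G\<^esub> (h \<otimes>\<^bsub>G\<^esub> k) = H #>\<^bsub>G\<^esub> k"
      using G.coset_mult_assoc[OF H.subset hG k] G.coset_join2[OF hG H h] by simp
    ultimately show ?thesis by (simp add: rep_def)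
  qed
  define s where "s x = (if x = \<one>\<^bsub>G\<^esub> then \<one>\<^bsub>G'\<^esub>
      else SOME y. y \<in> carrier G' \<and> y <#\<^bsub>G'\<^esub> A' = f (x <#\<^bsub>G\<^esub> A))" for x
  have s: "s x \<in> carrier G' \<and> s x <#\<^bsub>G'\<^esub> A' = f (x <#\<^bsub>G\<^esub> A)" if x: "x \<in> carrier G" for x
  proof (cases "x = \<one>\<^bsub>G\<^esub>")
    case True
    then show ?thesis
      using fA AG A'G by (simp add: s_def G.lcos_mult_one G'.lcos_mult_one)
  next
    case False
    have "\<exists>y. y \<in> carrier G' \<and> y <#\<^bsub>G'\<^esub> A' = f (x <#\<^bsub>G\<^esub> A)"
      using f[OF lcosetsI[OF x, of A]] by (auto simp: LCOSETS_def)
    from someI_ex[OF this] show ?thesis using False by (simp add: s_def)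
  qed
  define \<sigma> where "\<sigma> k = \<theta> (k \<otimes>\<^bsub>G\<^esub> inv\<^bsub>G\<^esub> rep k) \<otimes>\<^bsub>G'\<^esub> s (rep k)" for k
  show thesis
  proof
    show "\<sigma> k \<in> carrier G'" if "k \<in> carrier G" for k
      using \<theta>_closed rep_H s rep_closed that by (simp add: \<sigma>_def)
    show "\<sigma> k <#\<^bsub>G'\<^esub> A' = f (k <#\<^bsub>G\<^esub> A)" if k: "k \<in> carrier G" for k
    proof -
      let ?h = "k \<otimes>\<^bsub>G\<^esub> inv\<^bsub>G\<^esub> rep k"
      have "\<sigma> k <#\<^bsub>G'\<^esub> A' = \<theta> ?h <#\<^bsub>G'\<^esub> (s (rep k) <#\<^bsub>G'\<^esub> A')"
        using \<theta>_closed rep_H s[THEN conjunct1] rep_closed k A'G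
        by (simp add: \<sigma>_def G'.lcos_m_assoc)
      also have "\<dots> = f (?h <#\<^bsub>G\<^esub> (rep k <#\<^bsub>G\<^esub> A))"
        using f_equivariant rep_H s rep_closed k lcosetsI[of "rep k" G A] by simp
      also have "?h <#\<^bsub>G\<^esub> (rep k <#\<^bsub>G\<^esub> A) = k <#\<^bsub>G\<^esub> A"
        using AG k rep_closed[OF k] by (simp add: G.lcos_m_assoc G.m_assoc)
      finally show ?thesis .
    qed
    show "\<sigma> (h \<otimes>\<^bsub>G\<^esub> k) = \<theta> h \<otimes>\<^bsub>G'\<^esub> \<sigma> k" if h: "h \<in> H" and k: "k \<in> carrier G" for h k
      using h k rep_H[OF k] rep_closed[OF k] s \<theta>_closed
      by (simp add: \<sigma>_def rep_mult G.m_assoc \<theta>_mult G'.m_assoc)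
    show "\<sigma> h = \<theta> h" if h: "h \<in> H" for h
      using h \<theta>_closed by (simp add: \<sigma>_def rep_def s_def)
  qed
qed

lemma equivariant_liftI:
  assumes "group G" and "group G'" and A: "subgroup A G" and A': "subgroup A' G'"
    and \<sigma>: "\<And>k. k \<in> carrier G \<Longrightarrow> \<sigma> k \<in> carrier G'"
      "\<And>k. k \<in> carrier G \<Longrightarrow> \<sigma> k <#\<^bsub>G'\<^esub> A' = f (k <#\<^bsub>G\<^esub> A)"
      "\<And>h k. h \<in> H \<Longrightarrow> k \<in> carrier G \<Longrightarrow> \<sigma> (h \<otimes>\<^bsub>G\<^esub> k) = \<theta> h \<otimes>\<^bsub>G'\<^esub> \<sigma> k"
      "\<And>h. h \<in> H \<Longrightarrow> \<sigma> h = \<theta> h"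
    and \<tau>: "\<And>k. k \<in> carrier G' \<Longrightarrow> \<tau> k \<in> carrier G"
      "\<And>k. k \<in> carrier G' \<Longrightarrow> \<tau> k <#\<^bsub>G\<^esub> A = f' (k <#\<^bsub>G'\<^esub> A')"
      "\<And>h. h \<in> H' \<Longrightarrow> \<tau> h = \<theta>' h"
    and f'f: "\<And>P. P \<in> lcosets\<^bsub>G\<^esub> A \<Longrightarrow> f' (f P) = P"
    and \<theta>: "\<And>h. h \<in> H \<Longrightarrow> \<theta> h \<in> H'" "\<And>h. h \<in> H \<Longrightarrow> \<theta>' (\<theta> h) = h"
  shows "equivariant_lift G A H G' A' H' \<sigma> \<tau>"
proof -
  interpret G: group G by fact
  interpret G': group G' by fact
  have "inv\<^bsub>G\<^esub> k \<otimes>\<^bsub>G\<^esub> \<tau> (\<sigma> k) \<in> A" if k: "k \<in> carrier G" for k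
  proof -
    have "\<tau> (\<sigma> k) <#\<^bsub>G\<^esub> A = k <#\<^bsub>G\<^esub> A"
      using k \<sigma> \<tau> f'f lcosetsI[OF k, of A] by simp
    then show ?thesis
      using G.lcos_eq_iff[OF A k \<tau>(1)[OF \<sigma>(1)[OF k]]] by simp
  qed
  moreover have "inv\<^bsub>G'\<^esub> \<sigma> k \<otimes>\<^bsub>G'\<^esub> \<sigma> (k \<otimes>\<^bsub>G\<^esub> a) \<in> A'" if k: "k \<in> carrier G" and a: "a \<in> A" for k a
  proof -
    have aG: "a \<in> carrier G" using subgroup.mem_carrier[OF A a] .
    have "k <#\<^bsub>G\<^esub> A = (k \<otimes>\<^bsub>G\<^esub> a) <#\<^bsub>G\<^esub> A"
      using k a aG by (simp add: G.lcos_eq_iff[OF A] flip: G.m_assoc)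
    then have "\<sigma> k <#\<^bsub>G'\<^esub> A' = \<sigma> (k \<otimes>\<^bsub>G\<^esub> a) <#\<^bsub>G'\<^esub> A'"
      using k aG \<sigma>(2) by simp
    then show ?thesis
      using k aG \<sigma>(1) G'.lcos_eq_iff[OF A'] by simp
  qed
  ultimately show ?thesis
    using \<sigma> \<tau>(3) \<theta> unfolding equivariant_lift_def by simp
qed

text \<open>
  The given bijection need not send the coset \<open>A\<close> to the coset \<open>A'\<close>.  If it sends \<open>A\<close> to
  \<open>g A'\<close>, translation by \<open>g\<^sup>-\<^sup>1\<close> corrects this at the price of replacing \<open>H'\<close> by its conjugate
  \<open>g\<^sup>-\<^sup>1 H' g\<close>, which has finite index as well.  This is why \<open>H'\<close> is existentially quantified anew in
  the conclusion.
\<close>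

lemma ex_mutually_inverse_lifts:
  assumes "group G" and "group G'" and A: "subgroup A G" and A': "subgroup A' G'"
    and H: "finite_index_subgroup H G" and H': "finite_index_subgroup H' G'"
    and iso: "equivariantly_isomorphic
      (G\<lparr>carrier := H\<rparr>) (lcosets\<^bsub>G\<^esub> A) (coset_action G A)
      (G'\<lparr>carrier := H'\<rparr>) (lcosets\<^bsub>G'\<^esub> A') (coset_action G' A')"
  shows "\<exists>H' \<sigma> \<tau>. finite_index_subgroup H' G' \<and>
    equivariant_lift G A H G' A' H' \<sigma> \<tau> \<and> equivariant_lift G' A' H' G A H \<tau> \<sigma>"
proof -
  interpret G: group G by fact
  interpret G': group G' by fact
  have HG: "subgroup H G" and H'G: "subgroup H' G'"
    using H H' by (auto simp: finite_index_subgroup_def)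
  have A'G: "A' \<subseteq> carrier G'" and AG: "A \<subseteq> carrier G"
    using A A' subgroup.subset by blast+
  obtain \<theta>0 f0 where \<theta>0: "\<theta>0 \<in> iso (G\<lparr>carrier := H\<rparr>) (G'\<lparr>carrier := H'\<rparr>)"
    and f0: "bij_betw f0 (lcosets\<^bsub>G\<^esub> A) (lcosets\<^bsub>G'\<^esub> A')"
    and eq0: "\<And>h P. h \<in> H \<Longrightarrow> P \<in> lcosets\<^bsub>G\<^esub> A \<Longrightarrow>
      f0 (coset_action G A h P) = coset_action G' A' (\<theta>0 h) (f0 P)"
    using iso by (auto simp: equivariantly_isomorphic_def)
  have \<theta>0H: "\<theta>0 h \<in> H'" and \<theta>0G: "\<theta>0 h \<in> carrier G'" if "h \<in> H" for h
    using \<theta>0 that subgroup.mem_carrier[OF H'G] by (auto simp: iso_def hom_def)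
  have \<theta>0_mult: "\<theta>0 (h \<otimes>\<^bsub>G\<^esub> h') = \<theta>0 h \<otimes>\<^bsub>G'\<^esub> \<theta>0 h'" if "h \<in> H" "h' \<in> H" for h h'
    using \<theta>0 that by (auto simp: iso_def hom_def)
  have \<theta>0_bij: "bij_betw \<theta>0 H H'" using \<theta>0 by (simp add: iso_def)
  have A_coset: "A \<in> lcosets\<^bsub>G\<^esub> A"
    using lcosetsI[of "\<one>\<^bsub>G\<^esub>" G A] AG by (simp add: G.lcos_mult_one)
  have "f0 A \<in> lcosets\<^bsub>G'\<^esub> A'" using f0 A_coset by (auto simp: bij_betw_def)
  then obtain g where g: "g \<in> carrier G'" and gA: "f0 A = g <#\<^bsub>G'\<^esub> A'"
    by (auto simp: LCOSETS_def)
  define conj where "conj x = inv\<^bsub>G'\<^esub> g \<otimes>\<^bsub>G'\<^esub> x \<otimes>\<^bsub>G'\<^esub> g" for x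
  define unconj where "unconj x = g \<otimes>\<^bsub>G'\<^esub> x \<otimes>\<^bsub>G'\<^esub> inv\<^bsub>G'\<^esub> g" for x
  have cancel: "g \<otimes>\<^bsub>G'\<^esub> (inv\<^bsub>G'\<^esub> g \<otimes>\<^bsub>G'\<^esub> x) = x" "inv\<^bsub>G'\<^esub> g \<otimes>\<^bsub>G'\<^esub> (g \<otimes>\<^bsub>G'\<^esub> x) = x"
    if "x \<in> carrier G'" for x
    using that g by (simp_all flip: G'.m_assoc)
  have conj_closed: "conj x \<in> carrier G'" "unconj x \<in> carrier G'" if "x \<in> carrier G'" for x
    using that g by (simp_all add: conj_def unconj_def)
  have conj_mult: "conj (x \<otimes>\<^bsub>G'\<^esub> y) = conj x \<otimes>\<^bsub>G'\<^esub> conj y"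
    and unconj_mult: "unconj (x \<otimes>\<^bsub>G'\<^esub> y) = unconj x \<otimes>\<^bsub>G'\<^esub> unconj y"
    if "x \<in> carrier G'" "y \<in> carrier G'" for x y
    using that g by (simp_all add: conj_def unconj_def G'.m_assoc cancel)
  have conj_unconj: "conj (unconj x) = x" "unconj (conj x) = x" if "x \<in> carrier G'" for x
    using that g by (simp_all add: conj_def unconj_def G'.m_assoc cancel)
  define H'' where "H'' = {x \<in> carrier G'. unconj x \<in> H'}"
  have "unconj \<in> hom G' G'" using conj_closed unconj_mult by (simp add: hom_def)
  then have H'': "finite_index_subgroup H'' G'"
    unfolding H''_def using finite_index_subgroup_preimage[OF \<open>group G'\<close> \<open>group G'\<close> _ H'] by blast
  have H''G: "subgroup H'' G'" using H'' by (simp add: finite_index_subgroup_def)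
  define \<theta> where "\<theta> h = conj (\<theta>0 h)" for h
  define f where "f P = inv\<^bsub>G'\<^esub> g <#\<^bsub>G'\<^esub> f0 P" for P
  have \<theta>_bij: "bij_betw \<theta> H H''"
  proof -
    have "bij_betw conj H' H''"
      by (rule bij_betw_byWitness[where f' = unconj])
        (use subgroup.mem_carrier[OF H'G] conj_closed conj_unconj in \<open>auto simp: H''_def\<close>)
    from bij_betw_trans[OF \<theta>0_bij this] show ?thesis by (simp add: \<theta>_def[abs_def] comp_def)
  qed
  have \<theta>_H: "\<theta> h \<in> H''" if "h \<in> H" for h using \<theta>_bij that by (auto simp: bij_betw_def)
  have \<theta>_mult: "\<theta> (h \<otimes>\<^bsub>G\<^esub> h') = \<theta> h \<otimes>\<^bsub>G'\<^esub> \<theta> h'" if "h \<in> H" "h' \<in> H" for h h'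
    using that \<theta>0G by (simp add: \<theta>_def \<theta>0_mult conj_mult)
  have \<theta>_hom: "\<theta> \<in> hom (G\<lparr>carrier := H\<rparr>) G'"
    using \<theta>_mult \<theta>0G conj_closed by (simp add: hom_def \<theta>_def)
  have P'G: "P \<subseteq> carrier G'" if "P \<in> lcosets\<^bsub>G'\<^esub> A'" for P
    using that G'.lcosets_subset_PowG[OF A'] by blast
  have translate: "x <#\<^bsub>G'\<^esub> P \<in> lcosets\<^bsub>G'\<^esub> A'" if "x \<in> carrier G'" "P \<in> lcosets\<^bsub>G'\<^esub> A'" for x P
    using that A'G by (auto simp: LCOSETS_def G'.lcos_m_assoc)
  have f0_coset: "f0 P \<in> lcosets\<^bsub>G'\<^esub> A'" if "P \<in> lcosets\<^bsub>G\<^esub> A" for P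
    using f0 that by (auto simp: bij_betw_def)
  have f_bij: "bij_betw f (lcosets\<^bsub>G\<^esub> A) (lcosets\<^bsub>G'\<^esub> A')"
  proof -
    have "bij_betw (\<lambda>P. inv\<^bsub>G'\<^esub> g <#\<^bsub>G'\<^esub> P) (lcosets\<^bsub>G'\<^esub> A') (lcosets\<^bsub>G'\<^esub> A')"
      by (rule bij_betw_byWitness[where f' = "\<lambda>P. g <#\<^bsub>G'\<^esub> P"])
        (use g translate P'G in \<open>auto simp: G'.lcos_m_assoc G'.lcos_mult_one\<close>)
    from bij_betw_trans[OF f0 this] show ?thesis by (simp add: f_def[abs_def] comp_def)
  qed
  have f_coset: "f P \<in> lcosets\<^bsub>G'\<^esub> A'" if "P \<in> lcosets\<^bsub>G\<^esub> A" for P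
    using f_bij that by (auto simp: bij_betw_def)
  have f_eq: "f (h <#\<^bsub>G\<^esub> P) = \<theta> h <#\<^bsub>G'\<^esub> f P" if h: "h \<in> H" and P: "P \<in> lcosets\<^bsub>G\<^esub> A" for h P
  proof -
    have "f (h <#\<^bsub>G\<^esub> P) = inv\<^bsub>G'\<^esub> g <#\<^bsub>G'\<^esub> (\<theta>0 h <#\<^bsub>G'\<^esub> f0 P)"
      using eq0[OF h P] P f0_coset[OF P] by (simp add: f_def coset_action_def)
    also have "\<dots> = \<theta> h <#\<^bsub>G'\<^esub> f P"
      using g \<theta>0G[OF h] P'G[OF f0_coset[OF P]]
      by (simp add: f_def \<theta>_def conj_def G'.lcos_m_assoc G'.m_assoc)
    finally show ?thesis .
  qed
  have fA: "f A = A'"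
    using g A'G by (simp add: f_def gA G'.lcos_m_assoc G'.lcos_mult_one)

  define \<theta>' where "\<theta>' = inv_into H \<theta>"
  define f' where "f' = inv_into (lcosets\<^bsub>G\<^esub> A) f"
  have \<theta>'\<theta>: "\<theta>' (\<theta> h) = h" if "h \<in> H" for h
    using \<theta>_bij that by (simp add: \<theta>'_def bij_betw_inv_into_left)
  have \<theta>\<theta>': "\<theta> (\<theta>' h) = h" if "h \<in> H''" for h
    using \<theta>_bij that by (simp add: \<theta>'_def bij_betw_inv_into_right)
  have \<theta>'_H: "\<theta>' h \<in> H" if "h \<in> H''" for h
    using \<theta>_bij that by (auto simp: \<theta>'_def bij_betw_def inv_into_into)
  have f'f: "f' (f P) = P" if "P \<in> lcosets\<^bsub>G\<^esub> A" for P
    using f_bij that by (simp add: f'_def bij_betw_inv_into_left)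
  have ff': "f (f' P) = P" if "P \<in> lcosets\<^bsub>G'\<^esub> A'" for P
    using f_bij that by (simp add: f'_def bij_betw_inv_into_right)
  have f'_coset: "f' P \<in> lcosets\<^bsub>G\<^esub> A" if "P \<in> lcosets\<^bsub>G'\<^esub> A'" for P
    using f_bij that by (auto simp: f'_def bij_betw_def inv_into_into)
  have \<theta>'_hom: "\<theta>' \<in> hom (G'\<lparr>carrier := H''\<rparr>) G"
  proof (rule homI)
    fix x y assume *: "x \<in> carrier (G'\<lparr>carrier := H''\<rparr>)" "y \<in> carrier (G'\<lparr>carrier := H''\<rparr>)"
    have "\<theta>' (\<theta> (\<theta>' x \<otimes>\<^bsub>G\<^esub> \<theta>' y)) = \<theta>' x \<otimes>\<^bsub>G\<^esub> \<theta>' y"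
      using * \<theta>'_H by (intro \<theta>'\<theta> subgroup.m_closed[OF HG]) simp_all
    then show "\<theta>' (x \<otimes>\<^bsub>G'\<lparr>carrier := H''\<rparr>\<^esub> y) = \<theta>' x \<otimes>\<^bsub>G\<^esub> \<theta>' y"
      using * \<theta>'_H \<theta>\<theta>' by (simp add: \<theta>_mult)
  qed (use \<theta>'_H subgroup.mem_carrier[OF HG] in simp)
  have f'_eq: "f' (h <#\<^bsub>G'\<^esub> P) = \<theta>' h <#\<^bsub>G\<^esub> f' P" if h: "h \<in> H''" and P: "P \<in> lcosets\<^bsub>G'\<^esub> A'" for h P
  proof -
    have "\<theta>' h <#\<^bsub>G\<^esub> f' P \<in> lcosets\<^bsub>G\<^esub> A"
      using f'_coset[OF P] subgroup.mem_carrier[OF HG \<theta>'_H[OF h]] AG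
      by (auto simp: LCOSETS_def G.lcos_m_assoc)
    moreover have "f (\<theta>' h <#\<^bsub>G\<^esub> f' P) = h <#\<^bsub>G'\<^esub> P"
      using f_eq[OF \<theta>'_H[OF h] f'_coset[OF P]] by (simp add: \<theta>\<theta>' ff' h P)
    ultimately show ?thesis using f'f by metis
  qed
  have f'A': "f' A' = A" using f'f[OF A_coset] fA by simp

  obtain \<sigma> where \<sigma>: "\<And>k. k \<in> carrier G \<Longrightarrow> \<sigma> k \<in> carrier G'"
      "\<And>k. k \<in> carrier G \<Longrightarrow> \<sigma> k <#\<^bsub>G'\<^esub> A' = f (k <#\<^bsub>G\<^esub> A)"
      "\<And>h k. h \<in> H \<Longrightarrow> k \<in> carrier G \<Longrightarrow> \<sigma> (h \<otimes>\<^bsub>G\<^esub> k) = \<theta> h \<otimes>\<^bsub>G'\<^esub> \<sigma> k"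
      "\<And>h. h \<in> H \<Longrightarrow> \<sigma> h = \<theta> h"
    using ex_equivariant_coset_map_lift[OF \<open>group G\<close> \<open>group G'\<close> A A' HG \<theta>_hom f_coset f_eq fA]
    by blast
  obtain \<tau> where \<tau>: "\<And>k. k \<in> carrier G' \<Longrightarrow> \<tau> k \<in> carrier G"
      "\<And>k. k \<in> carrier G' \<Longrightarrow> \<tau> k <#\<^bsub>G\<^esub> A = f' (k <#\<^bsub>G'\<^esub> A')"
      "\<And>h k. h \<in> H'' \<Longrightarrow> k \<in> carrier G' \<Longrightarrow> \<tau> (h \<otimes>\<^bsub>G'\<^esub> k) = \<theta>' h \<otimes>\<^bsub>G\<^esub> \<tau> k"
      "\<And>h. h \<in> H'' \<Longrightarrow> \<tau> h = \<theta>' h"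
    using ex_equivariant_coset_map_lift[OF \<open>group G'\<close> \<open>group G\<close> A' A H''G \<theta>'_hom f'_coset f'_eq f'A']
    by blast
  have "equivariant_lift G A H G' A' H'' \<sigma> \<tau>"
    by (rule equivariant_liftI[OF \<open>group G\<close> \<open>group G'\<close> A A' \<sigma> \<tau>(1,2,4) f'f \<theta>_H \<theta>'\<theta>])
  moreover have "equivariant_lift G' A' H'' G A H \<tau> \<sigma>"
    by (rule equivariant_liftI[OF \<open>group G'\<close> \<open>group G\<close> A' A \<tau> \<sigma>(1,2,4) ff' \<theta>'_H \<theta>\<theta>'])
  ultimately show ?thesis using H'' by blast
qed

section \<open>Graph products\<close>

text \<open>
  All the groups in the diagram of a graph product share the multiplication of the full product and
  differ in their carriers only, so that they form a \<open>subgroup_diagram\<close>.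
\<close>

definition pair_product_carrier ::
  "'v set \<Rightarrow> ('v \<Rightarrow> ('a, 'm) monoid_scheme) \<Rightarrow> ('v \<Rightarrow> 'a set) \<Rightarrow> 'v set \<Rightarrow> ('v \<Rightarrow> 'a) set"
  where "pair_product_carrier V G A S = (\<Pi>\<^sub>E v\<in>V. if v \<in> S then carrier (G v) else A v)"

lemma pair_product_eq:
  "pair_product V G A S = (product_group V G)\<lparr>carrier := pair_product_carrier V G A S\<rparr>"
  by (auto simp: pair_product_def product_group_def pair_product_carrier_def fun_eq_iff
      restrict_def intro!: PiE_cong)

lemma subgroup_diagram_graph_product:
  assumes G: "\<And>v. v \<in> V \<Longrightarrow> group (G v)" and A: "\<And>v. v \<in> V \<Longrightarrow> subgroup (A v) (G v)"
  shows "subgroup_diagram (complete_subgraphs V E) (\<subseteq>) (product_group V G)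
    (pair_product_carrier V G A) {}"
proof (intro subgroup_diagram.intro subgroup_diagram_axioms.intro)
  show "group (product_group V G)" using G by (rule product_group)
  show "subgroup (pair_product_carrier V G A S) (product_group V G)" for S
    unfolding pair_product_carrier_def
    using G A by (simp add: PiE_subgroup_product_group group.subgroup_self)
  show "pair_product_carrier V G A S \<subseteq> pair_product_carrier V G A T" if "S \<subseteq> T" for S T
    unfolding pair_product_carrier_def
    using that subgroup.subset[OF A] by (intro PiE_mono) auto
qed (simp_all add: complete_subgraphs_def)

text \<open>
  In a coordinate \<open>v\<close> outside \<open>S\<close>, a letter \<open>g\<close> from the group of \<open>S\<close> has \<open>g v\<close> in \<open>A v\<close>, so the
  coset of \<open>A' v\<close> reached by \<open>\<sigma> v\<close> does not change; in a coordinate \<open>v\<close> in \<open>S\<close> every element of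
  \<open>G' v\<close> is a possible step.
\<close>

lemma equivariant_coset_lift_product:
  assumes G: "\<And>v. v \<in> V \<Longrightarrow> group (G v)" and A: "\<And>v. v \<in> V \<Longrightarrow> subgroup (A v) (G v)"
    and G': "\<And>v. v \<in> V \<Longrightarrow> group (G' v)" and A': "\<And>v. v \<in> V \<Longrightarrow> subgroup (A' v) (G' v)"
    and H: "\<And>v. v \<in> V \<Longrightarrow> subgroup (H v) (G v)"
    and lift: "\<And>v. v \<in> V \<Longrightarrow> equivariant_lift (G v) (A v) (H v) (G' v) (A' v) (H' v) (\<sigma> v) (\<tau> v)"
  shows "equivariant_coset_lift (complete_subgraphs V E) (\<subseteq>)
    (product_group V G) (pair_product_carrier V G A)
    (product_group V G') (pair_product_carrier V G' A') {}
    (\<lambda>k. \<lambda>v\<in>V. \<sigma> v (k v)) (PiE V H) (PiE V H')"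
proof (intro equivariant_coset_lift.intro coset_lift.intro coset_lift_axioms.intro
    equivariant_coset_lift_axioms.intro subgroup_diagram_graph_product)
  have \<sigma>: "\<sigma> v k \<in> carrier (G' v)" "inv\<^bsub>G' v\<^esub> \<sigma> v k \<otimes>\<^bsub>G' v\<^esub> \<sigma> v (k \<otimes>\<^bsub>G v\<^esub> a) \<in> A' v"
    "\<sigma> v h \<in> H' v" "\<sigma> v (h \<otimes>\<^bsub>G v\<^esub> k) = \<sigma> v h \<otimes>\<^bsub>G' v\<^esub> \<sigma> v k"
    if "v \<in> V" "k \<in> carrier (G v)" "a \<in> A v" "h \<in> H v" for v k a h
    using lift[OF that(1)] that(2-) unfolding equivariant_lift_def by blast+
  have oneA: "\<one>\<^bsub>G v\<^esub> \<in> A v" and oneH: "\<one>\<^bsub>G v\<^esub> \<in> H v" if "v \<in> V" for v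
    using that A H subgroup.one_closed by blast+
  note \<sigma>_closed = \<sigma>(1)[OF _ _ oneA oneH]
  show closed: "(\<lambda>v\<in>V. \<sigma> v (k v)) \<in> carrier (product_group V G')"
    if "k \<in> carrier (product_group V G)" for k
    using that \<sigma>_closed by (auto simp: PiE_iff)
  show "inv\<^bsub>product_group V G'\<^esub> (\<lambda>v\<in>V. \<sigma> v (k v)) \<otimes>\<^bsub>product_group V G'\<^esub>
      (\<lambda>v\<in>V. \<sigma> v ((k \<otimes>\<^bsub>product_group V G\<^esub> g) v)) \<in> pair_product_carrier V G' A' S"
    if k: "k \<in> carrier (product_group V G)" and g: "g \<in> pair_product_carrier V G A S" for S k g
  proof -
    have "inv\<^bsub>G' v\<^esub> \<sigma> v (k v) \<otimes>\<^bsub>G' v\<^esub> \<sigma> v (k v \<otimes>\<^bsub>G v\<^esub> g v)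
        \<in> (if v \<in> S then carrier (G' v) else A' v)" if v: "v \<in> V" for v
    proof -
      interpret Gv: group "G v" using G[OF v] .
      interpret G'v: group "G' v" using G'[OF v] .
      have kv: "k v \<in> carrier (G v)" using k v by (auto simp: PiE_iff)
      have gv: "g v \<in> (if v \<in> S then carrier (G v) else A v)"
        using g v by (auto simp: PiE_iff pair_product_carrier_def)
      show ?thesis
        using kv gv \<sigma>_closed[OF v] \<sigma>(2)[OF v kv _ oneH[OF v]] v by (auto split: if_splits)
    qed
    then show ?thesis
      using closed[OF k] G' by (simp add: pair_product_carrier_def PiE_iff)
  qed
  show "subgroup (PiE V H) (product_group V G)"
    using G H by (simp add: PiE_subgroup_product_group)
  have HG: "h \<in> carrier (G v)" if "v \<in> V" "h \<in> H v" for v h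
    using subgroup.mem_carrier[OF H] that by blast
  show "(\<lambda>v\<in>V. \<sigma> v (h v)) \<in> PiE V H'" if "h \<in> PiE V H" for h
    using that \<sigma>(3)[OF _ HG oneA] by (auto simp: PiE_iff)
  show "(\<lambda>v\<in>V. \<sigma> v ((h \<otimes>\<^bsub>product_group V G\<^esub> k) v)) =
      (\<lambda>v\<in>V. \<sigma> v (h v)) \<otimes>\<^bsub>product_group V G'\<^esub> (\<lambda>v\<in>V. \<sigma> v (k v))"
    if "h \<in> PiE V H" "k \<in> carrier (product_group V G)" for h k
    using that \<sigma>(4)[OF _ _ oneA] by (auto simp: PiE_iff fun_eq_iff restrict_def)
qed (use assms in auto)

lemma product_lifts_inverse:
  assumes G: "\<And>v. v \<in> V \<Longrightarrow> group (G v)"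
    and lift: "\<And>v. v \<in> V \<Longrightarrow> equivariant_lift (G v) (A v) (H v) (G' v) (A' v) (H' v) (\<sigma> v) (\<tau> v)"
  shows "k \<in> carrier (product_group V G) \<Longrightarrow>
      inv\<^bsub>product_group V G\<^esub> k \<otimes>\<^bsub>product_group V G\<^esub>
        (\<lambda>v\<in>V. \<tau> v ((\<lambda>v\<in>V. \<sigma> v (k v)) v)) \<in> pair_product_carrier V G A {}"
    and "h \<in> PiE V H \<Longrightarrow> (\<lambda>v\<in>V. \<tau> v ((\<lambda>v\<in>V. \<sigma> v (h v)) v)) = h"
proof -
  have \<tau>\<sigma>: "k \<in> carrier (G v) \<Longrightarrow> inv\<^bsub>G v\<^esub> k \<otimes>\<^bsub>G v\<^esub> \<tau> v (\<sigma> v k) \<in> A v"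
    "h \<in> H v \<Longrightarrow> \<tau> v (\<sigma> v h) = h" if "v \<in> V" for v k h
    using lift[OF that] unfolding equivariant_lift_def by blast+
  show "inv\<^bsub>product_group V G\<^esub> k \<otimes>\<^bsub>product_group V G\<^esub>
        (\<lambda>v\<in>V. \<tau> v ((\<lambda>v\<in>V. \<sigma> v (k v)) v)) \<in> pair_product_carrier V G A {}"
    if "k \<in> carrier (product_group V G)"
    using that G \<tau>\<sigma>(1) by (simp add: pair_product_carrier_def PiE_iff)
  show "(\<lambda>v\<in>V. \<tau> v ((\<lambda>v\<in>V. \<sigma> v (h v)) v)) = h" if "h \<in> PiE V H"
    using that \<tau>\<sigma>(2) by (auto simp: PiE_iff fun_eq_iff extensional_def)
qed

theorem corollary4p2:
  fixes V :: "'v set" and E :: "('v \<times> 'v) set"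
    and G :: "'v \<Rightarrow> ('a, 'm) monoid_scheme" and A :: "'v \<Rightarrow> 'a set"
    and G' :: "'v \<Rightarrow> ('b, 'n) monoid_scheme" and A' :: "'v \<Rightarrow> 'b set"
  assumes "finite V" and "graph_on V E"
    and "\<And>v. v \<in> V \<Longrightarrow> group (G v)" and "\<And>v. v \<in> V \<Longrightarrow> subgroup (A v) (G v)"
    and "\<And>v. v \<in> V \<Longrightarrow> group (G' v)" and "\<And>v. v \<in> V \<Longrightarrow> subgroup (A' v) (G' v)"
    and "\<And>v. v \<in> V \<Longrightarrow> \<exists>H H'. finite_index_subgroup H (G v) \<and> finite_index_subgroup H' (G' v) \<and>
      equivariantly_isomorphic
        ((G v)\<lparr>carrier := H\<rparr>) (lcosets\<^bsub>G v\<^esub> (A v)) (coset_action (G v) (A v))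
        ((G' v)\<lparr>carrier := H'\<rparr>) (lcosets\<^bsub>G' v\<^esub> (A' v)) (coset_action (G' v) (A' v))"
  shows "commensurable (graph_product V E G A) (graph_product V E G' A')"
proof -
  have "\<exists>H H' \<sigma> \<tau>. finite_index_subgroup H (G v) \<and> finite_index_subgroup H' (G' v) \<and>
      equivariant_lift (G v) (A v) H (G' v) (A' v) H' \<sigma> \<tau> \<and>
      equivariant_lift (G' v) (A' v) H' (G v) (A v) H \<tau> \<sigma>" if v: "v \<in> V" for v
    using assms(7)[OF v] ex_mutually_inverse_lifts[OF assms(3,5,4,6)[OF v]] by meson
  then obtain H H' \<sigma> \<tau> where
    H: "\<And>v. v \<in> V \<Longrightarrow> finite_index_subgroup (H v) (G v)" and
    H': "\<And>v. v \<in> V \<Longrightarrow> finite_index_subgroup (H' v) (G' v)" and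
    \<sigma>: "\<And>v. v \<in> V \<Longrightarrow> equivariant_lift (G v) (A v) (H v) (G' v) (A' v) (H' v) (\<sigma> v) (\<tau> v)" and
    \<tau>: "\<And>v. v \<in> V \<Longrightarrow> equivariant_lift (G' v) (A' v) (H' v) (G v) (A v) (H v) (\<tau> v) (\<sigma> v)"
    by metis
  have sub: "subgroup (H v) (G v)" "subgroup (H' v) (G' v)" if "v \<in> V" for v
    using H H' that by (simp_all add: finite_index_subgroup_def)
  show ?thesis
    unfolding graph_product_def pair_product_eq
    using finite_index_subgroup_product[OF assms(1,3) H]
      finite_index_subgroup_product[OF assms(1,5) H']
    by (intro commensurable_colimits[OF
          equivariant_coset_lift_product[OF assms(3-6) sub(1) \<sigma>]
          equivariant_coset_lift_product[OF assms(5,6,3,4) sub(2) \<tau>]]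
        product_lifts_inverse[OF assms(3) \<sigma>] product_lifts_inverse[OF assms(5) \<tau>])
qed

end
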